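(* Let $p$ be a prime and $m\ge 1$ an integer. Let $\{F_\lambda\}_{\lambda\in\Lambda}$ be an $m$-dimensional continued fraction system, and let $T: D_m'\to D_m'$ be the transformation associated with $\{F_\lambda\}_{\lambda\in\Lambda}$. Then for any Borel subsets $A,B$ of $D_m'$, $$\lim_{n\to\infty}\mu_m(T^{-n}A\cap B)=\mu_m(A)\mu_m(B).$$
   Context: For $\alpha\in\mathbb{Q}_p$, $\mathrm{ord}(\alpha)$ is the $p$-adic valuation, with $\mathrm{ord}(0)=\infty$. Let $D_m=\{(x_1,\dots,x_m)\in\mathbb{Q}_p^m : 1,x_1,\dots,x_m \text{ are linearly independent over } \mathbb{Z}\}$ and $D_m'=D_m\cap(p\mathbb{Z}_p)^m$. LFT: Let $i\in\{1,\dots,m\}$, $\sigma$ a permutation of $\{1,\dots,m\}$, $\mathbf{p}=(p_1,\dots,p_m)\in(\mathbb{Q}^\times)^m$, $\mathbf{q}=(q_1,\dots,q_m)\in\mathbb{Q}^m$. The $m$-dimensional linear fractional transformation (LFT) with parameter $(i,\sigma,\mathbf{p},\mathbf{q})$ is the map $F:D_m\to D_m$, $F(x_1,\dots,x_m)=(y_1,\dots,y_m)$, where $y_k=p_k/x_i-q_k$ if $k=\sigma^{-1}(i)$ and $y_k=p_kx_{\sigma(k)}/x_i-q_k$ if $k\neq\sigma^{-1}(i)$. It is a bijection of $D_m$. Hyperbolic: with $s=\sigma^{-1}(i)$, $F$ is hyperbolic if (i) for every $k$, $p_k\ne0$ and $\mathrm{ord}(p_k)\ge0$; (ii) $\mathrm{ord}(q_s)\le0$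 and $\mathrm{ord}(p_s/q_s)>0$; (iii) if $k\ne s$ and $\mathrm{ord}(q_k)\le0$, then $\mathrm{ord}(p_s/q_s)-\mathrm{ord}(p_k/q_k)>0$; (iv) if $k\ne s$ and $\mathrm{ord}(q_k)>0$, then $\mathrm{ord}(p_s/q_s)-\mathrm{ord}(p_k)>0$. Continued fraction system: a family $\{F_\lambda\}_{\lambda\in\Lambda}$ of hyperbolic $m$-dimensional LFTs, $\Lambda$ countable, such that $\{F_\lambda^{-1}(D_m')\}_{\lambda\in\Lambda}$ is a partition of $D_m'$ (i.e. $D_m'$ is the disjoint union of these sets over $\lambda\in\Lambda$). The associated transformation is $T:D_m'\to D_m'$, $T(\alpha)=F_\lambda(\alpha)$ if $\alpha\in F_\lambda^{-1}(D_m')$. $\mu$ is the Haar measure on $(\mathbb{Q}_p,+)$ normalized by $\mu(pa+p^n\mathbb{Z}_p)=p^{-(n-1)}$ (so $\mu(p\mathbb{Z}_p)=1$), and $\mu_m=\mu^m$ is the product measure on $(p\mathbb{Z}_p)^m$. *)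

theory Defs
  imports "HOL-Probability.Probability" "HOL-Computational_Algebra.Primes"
begin

section \<open>The field of $p$-adic numbers\<close>

class prime_card =
  assumes prime_card: "prime CARD('a)"

text \<open>
  The prime \<open>p\<close> is the cardinality of the type parameter \<open>'p\<close>, so that the fields of \<open>p\<close>-adic
  numbers form a family of types. Each of them is the completion of \<^typ>\<open>rat\<close> with respect to
  the \<open>p\<close>-adic absolute value.
\<close>

definition rat_ord :: "nat \<Rightarrow> rat \<Rightarrow> int" where  \<comment> \<open>only meaningful for nonzero arguments\<close>
  "rat_ord p x = int (multiplicity (int p) (fst (quotient_of x)))
               - int (multiplicity (int p) (snd (quotient_of x)))"

definition rat_abs :: "nat \<Rightarrow> rat \<Rightarrow> real" where
  "rat_abs p x = (if x = 0 then 0 else real p powi (- rat_ord p x))"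

definition rat_eord :: "nat \<Rightarrow> rat \<Rightarrow> ereal" where
  "rat_eord p x = (if x = 0 then \<infinity> else ereal (of_int (rat_ord p x)))"

definition padic_cauchy :: "nat \<Rightarrow> (nat \<Rightarrow> rat) \<Rightarrow> bool" where
  "padic_cauchy p X \<longleftrightarrow> (\<forall>e>0. \<exists>k. \<forall>m\<ge>k. \<forall>n\<ge>k. rat_abs p (X m - X n) < e)"

definition padic_null :: "nat \<Rightarrow> (nat \<Rightarrow> rat) \<Rightarrow> bool" where
  "padic_null p X \<longleftrightarrow> (\<lambda>n. rat_abs p (X n)) \<longlonglongrightarrow> 0"

definition padic_rel :: "nat \<Rightarrow> (nat \<Rightarrow> rat) \<Rightarrow> (nat \<Rightarrow> rat) \<Rightarrow> bool" where
  "padic_rel p X Y \<longleftrightarrow> padic_cauchy p X \<and> padic_cauchy p Y \<and> padic_null p (\<lambda>n. X n - Y n)"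

context
  fixes p :: nat
  assumes p: "prime p"
begin

lemma prime_elem_int_p: "prime_elem (int p)"
  using p by simp

lemma rat_ord_divide:
  fixes a b :: int
  assumes "a \<noteq> 0" "b \<noteq> 0"
  shows "rat_ord p (of_int a / of_int b) = int (multiplicity (int p) a) - int (multiplicity (int p) b)"
proof -
  define x :: rat where "x = of_int a / of_int b"
  obtain c d where cd: "quotient_of x = (c, d)" by fastforce
  have d: "d > 0" using quotient_of_denom_pos[OF cd] .
  have x: "x = of_int c / of_int d" using quotient_of_div[OF cd] .
  have "x \<noteq> 0" using assms by (simp add: x_def)
  hence c: "c \<noteq> 0" using x by auto
  have "(of_int (a * d) :: rat) = of_int (c * b)"
    using x x_def d assms by (simp add: field_simps)
  hence "a * d = c * b" by (simp only: of_int_eq_iff)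
  hence "multiplicity (int p) (a * d) = multiplicity (int p) (c * b)" by simp
  hence "multiplicity (int p) a + multiplicity (int p) d = multiplicity (int p) c + multiplicity (int p) b"
    using assms c d by (simp add: prime_elem_multiplicity_mult_distrib[OF prime_elem_int_p])
  thus ?thesis by (simp add: rat_ord_def flip: x_def) (simp add: cd)
qed

lemma rat_cases_nz:
  fixes x :: rat
  assumes "x \<noteq> 0"
  obtains a b :: int where "a \<noteq> 0" "b \<noteq> 0" "x = of_int a / of_int b"
proof -
  obtain c d where cd: "quotient_of x = (c, d)" by fastforce
  show ?thesis using that[of c d] quotient_of_div[OF cd] quotient_of_denom_pos[OF cd] assms by auto
qed

lemma rat_ord_mult:
  assumes "x \<noteq> 0" "y \<noteq> 0"
  shows "rat_ord p (x * y) = rat_ord p x + rat_ord p y"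
proof -
  obtain a b where ab: "a \<noteq> 0" "b \<noteq> 0" "x = of_int a / of_int b" using rat_cases_nz assms by metis
  obtain c d where cd: "c \<noteq> 0" "d \<noteq> 0" "y = of_int c / of_int d" using rat_cases_nz assms by metis
  have "x * y = of_int (a * c) / of_int (b * d)" using ab cd by simp
  thus ?thesis using ab cd rat_ord_divide[of "a*c" "b*d"] rat_ord_divide[of a b] rat_ord_divide[of c d]
    by (simp add: prime_elem_multiplicity_mult_distrib[OF prime_elem_int_p])
qed

lemma rat_ord_minus [simp]: "rat_ord p (- x) = rat_ord p x"
proof (cases "x = 0")
  case False
  then obtain a b where ab: "a \<noteq> 0" "b \<noteq> 0" "x = of_int a / of_int b" using rat_cases_nz by metis
  have "- x = of_int (- a) / of_int b" using ab by simp
  moreover have "multiplicity (int p) (- a) = multiplicity (int p) a"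
    using multiplicity_times_unit_right[of "-1" "int p" a] by simp
  ultimately show ?thesis using ab rat_ord_divide[of "-a" b] rat_ord_divide[of a b] by simp
qed simp

lemma rat_ord_add:
  assumes "x \<noteq> 0" "y \<noteq> 0" "x + y \<noteq> 0"
  shows "rat_ord p (x + y) \<ge> min (rat_ord p x) (rat_ord p y)"
proof -
  obtain a b where ab: "a \<noteq> 0" "b \<noteq> 0" "x = of_int a / of_int b" using rat_cases_nz assms by metis
  obtain c d where cd: "c \<noteq> 0" "d \<noteq> 0" "y = of_int c / of_int d" using rat_cases_nz assms by metis
  let ?m = "multiplicity (int p)"
  have xy: "x + y = of_int (a * d + c * b) / of_int (b * d)" using ab cd by (simp add: field_simps)
  hence nz: "a * d + c * b \<noteq> 0" using assms by (metis div_0 of_int_0)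
  have nu: "\<not> is_unit (int p)" using prime_elem_int_p by (auto simp: prime_elem_def)
  have "int p ^ min (?m (a * d)) (?m (c * b)) dvd a * d + c * b"
    by (intro dvd_add multiplicity_dvd') auto
  hence "min (?m (a * d)) (?m (c * b)) \<le> ?m (a * d + c * b)"
    using nz nu by (simp add: power_dvd_iff_le_multiplicity)
  moreover have "?m (a * d) = ?m a + ?m d" "?m (c * b) = ?m c + ?m b" "?m (b * d) = ?m b + ?m d"
    using ab cd by (simp_all add: prime_elem_multiplicity_mult_distrib[OF prime_elem_int_p])
  moreover have "rat_ord p (x + y) = int (?m (a * d + c * b)) - int (?m (b * d))"
    unfolding xy using nz ab cd by (intro rat_ord_divide) auto
  moreover have "rat_ord p x = int (?m a) - int (?m b)" "rat_ord p y = int (?m c) - int (?m d)"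
    using ab cd rat_ord_divide by simp_all
  ultimately show ?thesis by linarith
qed

lemma rat_ord_1 [simp]: "rat_ord p 1 = 0"
  using rat_ord_divide[of 1 1] by simp

lemma p_gt_1: "real p > 1"
  using p prime_gt_1_nat by simp

lemma powi_p_inject: "real p powi k = real p powi l \<longleftrightarrow> k = l"
  using power_int_strict_increasing[OF _ p_gt_1, of k l] power_int_strict_increasing[OF _ p_gt_1, of l k]
  by (cases k l rule: linorder_cases) auto

lemma rat_abs_0 [simp]: "rat_abs p 0 = 0"
  by (simp add: rat_abs_def)

lemma rat_abs_nonneg [simp]: "rat_abs p x \<ge> 0"
  by (simp add: rat_abs_def)

lemma rat_abs_eq_0 [simp]: "rat_abs p x = 0 \<longleftrightarrow> x = 0"
  using p_gt_1 by (simp add: rat_abs_def)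

lemma rat_abs_pos [simp]: "rat_abs p x > 0 \<longleftrightarrow> x \<noteq> 0"
  using rat_abs_nonneg[of x] rat_abs_eq_0[of x] by linarith

lemma rat_abs_1 [simp]: "rat_abs p 1 = 1"
  by (simp add: rat_abs_def)

lemma rat_abs_minus [simp]: "rat_abs p (- x) = rat_abs p x"
  by (simp add: rat_abs_def)

lemma rat_abs_diff_commute: "rat_abs p (x - y) = rat_abs p (y - x)"
  using rat_abs_minus[of "x - y"] by simp

lemma rat_abs_mult: "rat_abs p (x * y) = rat_abs p x * rat_abs p y"
  using p_gt_1 by (auto simp: rat_abs_def rat_ord_mult power_int_add power_int_diff field_simps
      power_int_minus)

lemma rat_abs_inverse: "rat_abs p (inverse x) = inverse (rat_abs p x)"
proof (cases "x = 0")
  case False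
  have "rat_abs p x * rat_abs p (inverse x) = 1" using False by (simp flip: rat_abs_mult)
  thus ?thesis by (metis inverse_unique)
qed simp

lemma rat_abs_add_max: "rat_abs p (x + y) \<le> max (rat_abs p x) (rat_abs p y)"
proof (cases "x = 0 \<or> y = 0 \<or> x + y = 0")
  case True
  thus ?thesis by (auto simp: le_max_iff_disj)
next
  case False
  hence "rat_ord p x \<le> rat_ord p (x + y) \<or> rat_ord p y \<le> rat_ord p (x + y)"
    using rat_ord_add[of x y] by auto
  thus ?thesis using False p_gt_1
    by (auto simp: rat_abs_def le_max_iff_disj intro!: power_int_increasing)
qed

lemma rat_abs_add_eq:
  assumes "rat_abs p y < rat_abs p x"
  shows "rat_abs p (x + y) = rat_abs p x"
proof -
  have "rat_abs p x \<le> max (rat_abs p (x + y)) (rat_abs p y)"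
    using rat_abs_add_max[of "x + y" "- y"] by simp
  thus ?thesis using rat_abs_add_max[of x y] assms by linarith
qed

lemma rat_abs_triangle: "rat_abs p (x + y) \<le> rat_abs p x + rat_abs p y"
  using rat_abs_add_max[of x y] rat_abs_nonneg[of x] rat_abs_nonneg[of y] by linarith

lemma padic_null_bound:
  assumes "padic_null p X" "eventually (\<lambda>n. rat_abs p (Y n) \<le> c * rat_abs p (X n)) sequentially"
  shows "padic_null p Y"
  unfolding padic_null_def
proof (rule tendsto_sandwich[where f = "\<lambda>_. 0"])
  show "(\<lambda>n. c * rat_abs p (X n)) \<longlonglongrightarrow> 0"
    using tendsto_mult_right_zero assms(1) unfolding padic_null_def by blast
qed (use assms in auto)

lemma padic_null_zero: "padic_null p (\<lambda>_. 0)"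
  by (simp add: padic_null_def)

lemma padic_null_minus: "padic_null p (\<lambda>n. - X n) \<longleftrightarrow> padic_null p X"
  by (simp add: padic_null_def)

lemma padic_null_add:
  assumes "padic_null p X" "padic_null p Y"
  shows "padic_null p (\<lambda>n. X n + Y n)"
  unfolding padic_null_def
proof (rule tendsto_sandwich[where f = "\<lambda>_. 0"])
  show "(\<lambda>n. rat_abs p (X n) + rat_abs p (Y n)) \<longlonglongrightarrow> 0"
    using tendsto_add[of _ 0 sequentially _ 0] assms unfolding padic_null_def by fastforce
qed (auto simp: rat_abs_triangle)

lemma padic_null_diff:
  assumes "padic_null p X" "padic_null p Y"
  shows "padic_null p (\<lambda>n. X n - Y n)"
  using padic_null_add[of X "\<lambda>n. - Y n"] assms padic_null_minus by simp

lemma padic_null_const [simp]: "padic_null p (\<lambda>_. c) \<longleftrightarrow> c = 0"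
  by (simp add: padic_null_def LIMSEQ_const_iff)

lemma padic_cauchy_const [simp]: "padic_cauchy p (\<lambda>_. c)"
  by (simp add: padic_cauchy_def)

lemma padic_cauchy_cases:
  assumes "padic_cauchy p X"
  obtains "padic_null p X"
  | x where "x \<noteq> 0" "\<not> padic_null p X"
      "eventually (\<lambda>n. X n \<noteq> 0 \<and> rat_abs p (X n) = rat_abs p x \<and> rat_ord p (X n) = rat_ord p x) sequentially"
proof (cases "padic_null p X")
  case False
  then obtain e where e: "e > 0" "\<not> eventually (\<lambda>n. rat_abs p (X n) < e) sequentially"
    unfolding padic_null_def tendsto_iff by auto
  obtain k where k: "\<And>m n. m \<ge> k \<Longrightarrow> n \<ge> k \<Longrightarrow> rat_abs p (X m - X n) < e"
    using assms e(1) unfolding padic_cauchy_def by blast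
  obtain m where m: "m \<ge> k" "rat_abs p (X m) \<ge> e"
    using e(2) unfolding eventually_sequentially by (meson not_le)
  have nz: "X m \<noteq> 0" using m e by auto
  have *: "rat_abs p (X n) = rat_abs p (X m)" if "n \<ge> k" for n
    using rat_abs_add_eq[of "X n - X m" "X m"] k[OF that m(1)] m(2) by simp
  have "X n \<noteq> 0 \<and> rat_abs p (X n) = rat_abs p (X m) \<and> rat_ord p (X n) = rat_ord p (X m)"
    if "n \<ge> k" for n
  proof -
    have "X n \<noteq> 0" using *[OF that] nz rat_abs_eq_0 by metis
    moreover have "rat_ord p (X n) = rat_ord p (X m)"
      using *[OF that] \<open>X n \<noteq> 0\<close> nz by (simp add: rat_abs_def powi_p_inject)
    ultimately show ?thesis using *[OF that] by simp
  qed
  thus ?thesis using that(2)[of "X m"] nz False unfolding eventually_sequentially by blast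
qed (use that in blast)

lemma padic_cauchy_bounded:
  assumes "padic_cauchy p X"
  obtains b where "b > 0" "eventually (\<lambda>n. rat_abs p (X n) \<le> b) sequentially"
  using assms
proof (cases rule: padic_cauchy_cases)
  case 1
  hence "eventually (\<lambda>n. rat_abs p (X n) < 1) sequentially"
    unfolding padic_null_def by (rule order_tendstoD) simp
  hence "eventually (\<lambda>n. rat_abs p (X n) \<le> 1) sequentially"
    by (rule eventually_mono) simp
  thus ?thesis using that[of 1] by simp
next
  case (2 x)
  have "eventually (\<lambda>n. rat_abs p (X n) \<le> rat_abs p x) sequentially"
    using 2(3) by (rule eventually_mono) simp
  thus ?thesis using that[of "rat_abs p x"] 2(1) by simp
qed

lemma padic_cauchy_minus:
  assumes "padic_cauchy p X"
  shows "padic_cauchy p (\<lambda>n. - X n)"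
  using assms unfolding padic_cauchy_def by (simp add: rat_abs_diff_commute)

lemma padic_cauchy_add:
  assumes "padic_cauchy p X" "padic_cauchy p Y"
  shows "padic_cauchy p (\<lambda>n. X n + Y n)"
  unfolding padic_cauchy_def
proof (intro allI impI)
  fix e :: real assume "e > 0"
  obtain k where k: "\<And>m n. m \<ge> k \<Longrightarrow> n \<ge> k \<Longrightarrow> rat_abs p (X m - X n) < e"
    using assms(1) \<open>e > 0\<close> unfolding padic_cauchy_def by blast
  obtain l where l: "\<And>m n. m \<ge> l \<Longrightarrow> n \<ge> l \<Longrightarrow> rat_abs p (Y m - Y n) < e"
    using assms(2) \<open>e > 0\<close> unfolding padic_cauchy_def by blast
  have "rat_abs p (X m + Y m - (X n + Y n)) < e" if "m \<ge> max k l" "n \<ge> max k l" for m n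
    using k[of m n] l[of m n] rat_abs_add_max[of "X m - X n" "Y m - Y n"] that
    by (simp add: algebra_simps)
  thus "\<exists>k. \<forall>m\<ge>k. \<forall>n\<ge>k. rat_abs p (X m + Y m - (X n + Y n)) < e" by blast
qed

lemma padic_cauchy_mult:
  assumes "padic_cauchy p X" "padic_cauchy p Y"
  shows "padic_cauchy p (\<lambda>n. X n * Y n)"
  unfolding padic_cauchy_def
proof (intro allI impI)
  fix e :: real assume "e > 0"
  obtain a i where a: "a > 0" "\<And>n. n \<ge> i \<Longrightarrow> rat_abs p (X n) \<le> a"
    using padic_cauchy_bounded[OF assms(1)] unfolding eventually_sequentially by metis
  obtain b j where b: "b > 0" "\<And>n. n \<ge> j \<Longrightarrow> rat_abs p (Y n) \<le> b"
    using padic_cauchy_bounded[OF assms(2)] unfolding eventually_sequentially by metis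
  obtain k where k: "\<And>m n. m \<ge> k \<Longrightarrow> n \<ge> k \<Longrightarrow> rat_abs p (X m - X n) < e / b"
    using assms(1) \<open>e > 0\<close> b(1) unfolding padic_cauchy_def by (meson divide_pos_pos)
  obtain l where l: "\<And>m n. m \<ge> l \<Longrightarrow> n \<ge> l \<Longrightarrow> rat_abs p (Y m - Y n) < e / a"
    using assms(2) \<open>e > 0\<close> a(1) unfolding padic_cauchy_def by (meson divide_pos_pos)
  have "rat_abs p (X m * Y m - X n * Y n) < e"
    if mn: "m \<ge> Max {i, j, k, l}" "n \<ge> Max {i, j, k, l}" for m n
  proof -
    have "rat_abs p (X m) * rat_abs p (Y m - Y n) \<le> a * rat_abs p (Y m - Y n)"
      using a mn by (intro mult_right_mono) auto
    also have "\<dots> < e" using l[of m n] mn a(1) by (simp add: field_simps)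
    finally have 1: "rat_abs p (X m * (Y m - Y n)) < e" by (simp add: rat_abs_mult)
    have "rat_abs p (X m - X n) * rat_abs p (Y n) \<le> rat_abs p (X m - X n) * b"
      using b mn by (intro mult_left_mono) auto
    also have "\<dots> < e" using k[of m n] mn b(1) by (simp add: field_simps)
    finally have 2: "rat_abs p ((X m - X n) * Y n) < e" by (simp add: rat_abs_mult)
    have "X m * Y m - X n * Y n = X m * (Y m - Y n) + (X m - X n) * Y n"
      by (simp add: algebra_simps)
    thus ?thesis using 1 2 rat_abs_add_max[of "X m * (Y m - Y n)" "(X m - X n) * Y n"] by simp
  qed
  thus "\<exists>k. \<forall>m\<ge>k. \<forall>n\<ge>k. rat_abs p (X m * Y m - X n * Y n) < e" by blast
qed

lemma inverse_diff_inverse_rat_abs: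
  assumes "x \<noteq> 0" "y \<noteq> 0" "rat_abs p x = c" "rat_abs p y = d"
  shows "rat_abs p (inverse x - inverse y) = inverse c * inverse d * rat_abs p (x - y)"
proof -
  have "inverse x - inverse y = - (inverse x * inverse y * (x - y))"
    using assms by (simp add: field_simps)
  thus ?thesis using assms by (simp only: rat_abs_minus rat_abs_mult rat_abs_inverse)
qed

lemma padic_cauchy_inverse:
  assumes "padic_cauchy p X" "\<not> padic_null p X"
  shows "padic_cauchy p (\<lambda>n. inverse (X n))"
  unfolding padic_cauchy_def
proof (intro allI impI)
  fix e :: real assume "e > 0"
  obtain x i where x: "x \<noteq> 0" "\<And>n. n \<ge> i \<Longrightarrow> X n \<noteq> 0 \<and> rat_abs p (X n) = rat_abs p x"
    using padic_cauchy_cases[OF assms(1)] assms(2) unfolding eventually_sequentially by metis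
  define c where "c = rat_abs p x"
  have c: "c > 0" using x by (simp add: c_def)
  have "e * c * c > 0" using c \<open>e > 0\<close> by simp
  then obtain k where k: "\<And>m n. m \<ge> k \<Longrightarrow> n \<ge> k \<Longrightarrow> rat_abs p (X m - X n) < e * c * c"
    using assms(1) unfolding padic_cauchy_def by blast
  have "rat_abs p (inverse (X m) - inverse (X n)) < e" if "m \<ge> max i k" "n \<ge> max i k" for m n
  proof -
    have "rat_abs p (inverse (X m) - inverse (X n)) = inverse c * inverse c * rat_abs p (X m - X n)"
      using x(2)[of m] x(2)[of n] that unfolding c_def by (intro inverse_diff_inverse_rat_abs) auto
    also have "\<dots> < inverse c * inverse c * (e * c * c)"
      using k[of m n] that c by (intro mult_strict_left_mono) auto
    also have "inverse c * inverse c * (e * c * c) = e" using c by (simp add: field_simps)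
    finally show ?thesis .
  qed
  thus "\<exists>k. \<forall>m\<ge>k. \<forall>n\<ge>k. rat_abs p (inverse (X m) - inverse (X n)) < e" by blast
qed

lemma padic_null_inverse_diff:
  assumes "padic_cauchy p X" "\<not> padic_null p X" "padic_cauchy p Y" "\<not> padic_null p Y"
    and "padic_null p (\<lambda>n. X n - Y n)"
  shows "padic_null p (\<lambda>n. inverse (X n) - inverse (Y n))"
proof -
  obtain x where x: "eventually (\<lambda>n. X n \<noteq> 0 \<and> rat_abs p (X n) = rat_abs p x) sequentially"
    using padic_cauchy_cases[OF assms(1)] assms(2) by (smt (verit) eventually_mono)
  obtain y where y: "eventually (\<lambda>n. Y n \<noteq> 0 \<and> rat_abs p (Y n) = rat_abs p y) sequentially"
    using padic_cauchy_cases[OF assms(3)] assms(4) by (smt (verit) eventually_mono)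
  show ?thesis
  proof (rule padic_null_bound[OF assms(5)])
    show "eventually (\<lambda>n. rat_abs p (inverse (X n) - inverse (Y n))
        \<le> (inverse (rat_abs p x) * inverse (rat_abs p y)) * rat_abs p (X n - Y n)) sequentially"
      using x y
    proof eventually_elim
      case (elim n)
      thus ?case using inverse_diff_inverse_rat_abs[of "X n" "Y n"] by simp
    qed
  qed
qed

lemma padic_null_mult:
  assumes "padic_cauchy p X" "padic_null p Y"
  shows "padic_null p (\<lambda>n. X n * Y n)"
proof -
  obtain b where b: "b > 0" "eventually (\<lambda>n. rat_abs p (X n) \<le> b) sequentially"
    using padic_cauchy_bounded[OF assms(1)] by blast
  show ?thesis
  proof (rule padic_null_bound[OF assms(2)])
    show "eventually (\<lambda>n. rat_abs p (X n * Y n) \<le> b * rat_abs p (Y n)) sequentially"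
      using b(2) by eventually_elim (simp add: rat_abs_mult mult_right_mono)
  qed
qed

lemma padic_rel_null_iff:
  assumes "padic_rel p X Y"
  shows "padic_null p X \<longleftrightarrow> padic_null p Y"
proof -
  have n: "padic_null p (\<lambda>n. X n - Y n)" using assms by (simp add: padic_rel_def)
  show ?thesis using padic_null_diff[OF _ n, of X] padic_null_add[OF _ n, of Y] by auto
qed

lemma part_equivp_padic_rel: "part_equivp (padic_rel p)"
proof (rule part_equivpI)
  show "\<exists>X. padic_rel p X X"
    by (rule exI[of _ "\<lambda>_. 0"]) (simp add: padic_rel_def)
  show "symp (padic_rel p)"
  proof (rule sympI)
    fix X Y assume "padic_rel p X Y"
    thus "padic_rel p Y X"
      using padic_null_minus[of "\<lambda>n. X n - Y n"] by (simp add: padic_rel_def)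
  qed
  show "transp (padic_rel p)"
  proof (rule transpI)
    fix X Y Z assume "padic_rel p X Y" "padic_rel p Y Z"
    thus "padic_rel p X Z"
      using padic_null_add[of "\<lambda>n. X n - Y n" "\<lambda>n. Y n - Z n"] by (simp add: padic_rel_def)
  qed
qed

lemma padic_rel_imp_ord_eq:
  assumes "padic_rel p X Y"
  shows "padic_null p X \<and> padic_null p Y \<or>
    (\<exists>x. x \<noteq> 0 \<and> eventually (\<lambda>n. X n \<noteq> 0 \<and> rat_ord p (X n) = rat_ord p x) sequentially
       \<and> eventually (\<lambda>n. Y n \<noteq> 0 \<and> rat_ord p (Y n) = rat_ord p x) sequentially)"
proof (cases "padic_null p X")
  case False
  have cX: "padic_cauchy p X" and cY: "padic_cauchy p Y" and n: "padic_null p (\<lambda>n. X n - Y n)"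
    using assms by (simp_all add: padic_rel_def)
  have nY: "\<not> padic_null p Y" using False padic_rel_null_iff[OF assms] by simp
  obtain x where x: "x \<noteq> 0" "eventually (\<lambda>n. X n \<noteq> 0 \<and> rat_abs p (X n) = rat_abs p x \<and> rat_ord p (X n) = rat_ord p x) sequentially"
    using padic_cauchy_cases[OF cX] False by metis
  obtain y where y: "y \<noteq> 0" "eventually (\<lambda>n. Y n \<noteq> 0 \<and> rat_abs p (Y n) = rat_abs p y \<and> rat_ord p (Y n) = rat_ord p y) sequentially"
    using padic_cauchy_cases[OF cY] nY by metis
  have "eventually (\<lambda>n. rat_abs p (X n - Y n) < rat_abs p x) sequentially"
    using n x(1) unfolding padic_null_def by (intro order_tendstoD) auto
  with x(2) y(2) have "eventually (\<lambda>n. rat_ord p y = rat_ord p x) sequentially"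
  proof eventually_elim
    case (elim n)
    have "rat_abs p (Y n) = rat_abs p (X n)"
      using rat_abs_add_eq[of "Y n - X n" "X n"] elim by (simp add: rat_abs_diff_commute)
    hence "real p powi (- rat_ord p y) = real p powi (- rat_ord p x)"
      using elim x(1) y(1) by (simp add: rat_abs_def)
    thus ?case by (simp add: powi_p_inject)
  qed
  hence "rat_ord p y = rat_ord p x" by simp
  thus ?thesis using x y by (auto elim: eventually_mono intro!: exI[of _ x])
qed (use padic_rel_null_iff[OF assms] in auto)

lemma rat_eord_tendsto_infinity:
  assumes "padic_null p X"
  shows "(\<lambda>n. rat_eord p (X n)) \<longlonglongrightarrow> \<infinity>"
proof (rule Lim_PInfty[THEN iffD2], intro allI)
  fix B :: real
  obtain N :: int where N: "B \<le> of_int N" using ex_le_of_int by blast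
  have "eventually (\<lambda>n. rat_abs p (X n) < real p powi (- N)) sequentially"
    using assms p_gt_1 unfolding padic_null_def by (intro order_tendstoD) auto
  moreover have "rat_eord p x \<ge> ereal B" if "rat_abs p x < real p powi (- N)" for x
  proof (cases "x = 0")
    case False
    hence "real p powi (- rat_ord p x) < real p powi (- N)" using that by (simp add: rat_abs_def)
    hence "- rat_ord p x < - N"
      using p_gt_1 power_int_increasing[of "- N" "- rat_ord p x" "real p"] by linarith
    hence "B \<le> of_int (rat_ord p x)" using N by linarith
    thus ?thesis using False by (simp add: rat_eord_def)
  qed (simp add: rat_eord_def)
  ultimately show "\<exists>N. \<forall>n\<ge>N. ereal B \<le> rat_eord p (X n)"
    unfolding eventually_sequentially by blast
qed

lemma rat_eord_tendsto_const:
  assumes "x \<noteq> 0" "eventually (\<lambda>n. X n \<noteq> 0 \<and> rat_ord p (X n) = rat_ord p x) sequentially"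
  shows "(\<lambda>n. rat_eord p (X n)) \<longlonglongrightarrow> rat_eord p x"
proof (rule tendsto_eventually)
  show "eventually (\<lambda>n. rat_eord p (X n) = rat_eord p x) sequentially"
    using assms(2) by eventually_elim (simp add: rat_eord_def assms(1))
qed

lemma rat_eord_lim_eq:
  assumes "padic_rel p X Y"
  shows "lim (\<lambda>n. rat_eord p (X n)) = lim (\<lambda>n. rat_eord p (Y n))"
  using padic_rel_imp_ord_eq[OF assms]
proof (elim disjE exE conjE)
  fix x assume x: "x \<noteq> 0" "eventually (\<lambda>n. X n \<noteq> 0 \<and> rat_ord p (X n) = rat_ord p x) sequentially"
    "eventually (\<lambda>n. Y n \<noteq> 0 \<and> rat_ord p (Y n) = rat_ord p x) sequentially"
  show ?thesis
    using rat_eord_tendsto_const[OF x(1,2)] rat_eord_tendsto_const[OF x(1,3)] by (simp add: limI)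
next
  assume "padic_null p X" "padic_null p Y"
  thus ?thesis using rat_eord_tendsto_infinity[of X] rat_eord_tendsto_infinity[of Y] by (simp add: limI)
qed

lemma rat_eord_lim_cases:
  assumes "padic_cauchy p X"
  shows "padic_null p X \<and> (\<lambda>n. rat_eord p (X n)) \<longlonglongrightarrow> \<infinity> \<or>
    \<not> padic_null p X \<and> (\<exists>k::int. (\<lambda>n. rat_eord p (X n)) \<longlonglongrightarrow> ereal (of_int k))"
  using assms
proof (cases rule: padic_cauchy_cases)
  case (2 x)
  have "eventually (\<lambda>n. X n \<noteq> 0 \<and> rat_ord p (X n) = rat_ord p x) sequentially"
    using 2(3) by (auto elim: eventually_mono)
  hence "(\<lambda>n. rat_eord p (X n)) \<longlonglongrightarrow> rat_eord p x" by (rule rat_eord_tendsto_const[OF 2(1)])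
  thus ?thesis using 2(1,2) by (auto simp: rat_eord_def)
qed (simp add: rat_eord_tendsto_infinity)

lemma rat_eord_tendsto_lim:
  assumes "padic_cauchy p X"
  shows "(\<lambda>n. rat_eord p (X n)) \<longlonglongrightarrow> lim (\<lambda>n. rat_eord p (X n))"
  using rat_eord_lim_cases[OF assms] by (metis limI)

lemma rat_eord_add: "min (rat_eord p x) (rat_eord p y) \<le> rat_eord p (x + y)"
proof (cases "x = 0 \<or> y = 0 \<or> x + y = 0")
  case False
  thus ?thesis using rat_ord_add[of x y] by (auto simp: rat_eord_def min_def split: if_splits)
qed (auto simp: rat_eord_def)

lemma rat_eord_add_lim:
  assumes "padic_cauchy p X" "padic_cauchy p Y"
  shows "min (lim (\<lambda>n. rat_eord p (X n))) (lim (\<lambda>n. rat_eord p (Y n)))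
       \<le> lim (\<lambda>n. rat_eord p (X n + Y n))"
proof (rule tendsto_le)
  show "(\<lambda>n. rat_eord p (X n + Y n)) \<longlonglongrightarrow> lim (\<lambda>n. rat_eord p (X n + Y n))"
    by (rule rat_eord_tendsto_lim[OF padic_cauchy_add[OF assms]])
  show "(\<lambda>n. min (rat_eord p (X n)) (rat_eord p (Y n))) \<longlonglongrightarrow>
      min (lim (\<lambda>n. rat_eord p (X n))) (lim (\<lambda>n. rat_eord p (Y n)))"
    by (intro tendsto_min rat_eord_tendsto_lim assms)
qed (auto simp: rat_eord_add)

end

text \<open>
  This is spelled out with \<open>typedef\<close> because \<open>quotient_type\<close> does not accept the sort
  constraint on the type parameter.
\<close>

typedef ('p::prime_card) padic =
  "{C. \<exists>X. padic_rel CARD('p) X X \<and> C = Collect (padic_rel CARD('p) X)}"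
  by (rule exI[of _ "Collect (padic_rel CARD('p) (\<lambda>_. 0))"])
     (auto intro!: exI[of _ "\<lambda>_. 0"] simp: padic_rel_def padic_null_def rat_abs_def padic_cauchy_def)

definition Padic :: "(nat \<Rightarrow> rat) \<Rightarrow> 'p::prime_card padic" where
  "Padic X = Abs_padic (Collect (padic_rel CARD('p) X))"

definition padic_repr :: "'p::prime_card padic \<Rightarrow> nat \<Rightarrow> rat" where
  "padic_repr x = (SOME X. X \<in> Rep_padic x)"

definition cr_padic :: "(nat \<Rightarrow> rat) \<Rightarrow> 'p::prime_card padic \<Rightarrow> bool" where
  "cr_padic = (\<lambda>X x. padic_rel CARD('p) X X \<and> Padic X = x)"

lemma quot_type_padic:
  "quot_type (padic_rel CARD('p)) Abs_padic (Rep_padic :: 'p::prime_card padic \<Rightarrow> _)"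
proof
  show "part_equivp (padic_rel CARD('p))" by (rule part_equivp_padic_rel[OF prime_card])
  show "\<exists>X. padic_rel CARD('p) X X \<and> Rep_padic y = Collect (padic_rel CARD('p) X)"
    for y :: "'p padic" using Rep_padic[of y] by simp
  show "Abs_padic (Rep_padic x) = x" for x :: "'p padic" by (rule Rep_padic_inverse)
  show "Rep_padic (Abs_padic c :: 'p padic) = c"
    if "\<exists>x. padic_rel CARD('p) x x \<and> c = Collect (padic_rel CARD('p) x)" for c
    by (rule Abs_padic_inverse) (use that in simp)
  show "(Rep_padic x = Rep_padic y) = (x = y)" for x y :: "'p padic" by (rule Rep_padic_inject)
qed

lemma Quotient_padic:
  "Quotient (padic_rel CARD('p)) Padic padic_repr (cr_padic :: _ \<Rightarrow> 'p::prime_card padic \<Rightarrow> bool)"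
proof (rule Quotient3_to_Quotient)
  have 1: "quot_type.abs (padic_rel CARD('p)) Abs_padic = (Padic :: _ \<Rightarrow> 'p padic)"
    by (simp add: fun_eq_iff Padic_def quot_type.abs_def[OF quot_type_padic])
  have 2: "quot_type.rep Rep_padic = (padic_repr :: 'p padic \<Rightarrow> _)"
    by (simp add: fun_eq_iff padic_repr_def quot_type.rep_def[OF quot_type_padic])
  show "Quotient3 (padic_rel CARD('p)) Padic (padic_repr :: 'p padic \<Rightarrow> _)"
    using quot_type.Quotient[OF quot_type_padic[where 'p = 'p]] unfolding 1 2 .
  show "cr_padic \<equiv> \<lambda>X (x :: 'p padic). padic_rel CARD('p) X X \<and> Padic X = x"
    by (simp add: cr_padic_def)
qed

setup_lifting Quotient_padic

lemma padic_rel_refl: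
  assumes "padic_cauchy p X" shows "padic_rel p X X"
  using assms by (simp add: padic_rel_def padic_null_def rat_abs_def)

instantiation padic :: (prime_card) field
begin

lift_definition zero_padic :: "'a padic" is "\<lambda>_. 0"
  by (simp add: padic_rel_refl padic_cauchy_const[OF prime_card])

lift_definition one_padic :: "'a padic" is "\<lambda>_. 1"
  by (simp add: padic_rel_refl padic_cauchy_const[OF prime_card])

lift_definition plus_padic :: "'a padic \<Rightarrow> 'a padic \<Rightarrow> 'a padic" is "\<lambda>X Y n. X n + Y n"
proof -
  fix X X' Y Y' :: "nat \<Rightarrow> rat"
  assume "padic_rel CARD('a) X X'" "padic_rel CARD('a) Y Y'"
  thus "padic_rel CARD('a) (\<lambda>n. X n + Y n) (\<lambda>n. X' n + Y' n)"
    using padic_null_add[OF prime_card[where 'a = 'a], of "\<lambda>n. X n - X' n" "\<lambda>n. Y n - Y' n"]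
    by (simp add: padic_rel_def padic_cauchy_add[OF prime_card] algebra_simps)
qed

lift_definition uminus_padic :: "'a padic \<Rightarrow> 'a padic" is "\<lambda>X n. - X n"
proof -
  fix X X' :: "nat \<Rightarrow> rat"
  assume "padic_rel CARD('a) X X'"
  thus "padic_rel CARD('a) (\<lambda>n. - X n) (\<lambda>n. - X' n)"
    using padic_null_minus[OF prime_card[where 'a = 'a], of "\<lambda>n. X n - X' n"]
    by (simp add: padic_rel_def padic_cauchy_minus[OF prime_card])
qed

lift_definition times_padic :: "'a padic \<Rightarrow> 'a padic \<Rightarrow> 'a padic" is "\<lambda>X Y n. X n * Y n"
proof -
  fix X X' Y Y' :: "nat \<Rightarrow> rat"
  assume *: "padic_rel CARD('a) X X'" "padic_rel CARD('a) Y Y'"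
  have "padic_null CARD('a) (\<lambda>n. X n * (Y n - Y' n) + Y' n * (X n - X' n))"
    using * unfolding padic_rel_def
    by (intro padic_null_add[OF prime_card] padic_null_mult[OF prime_card]) auto
  hence "padic_null CARD('a) (\<lambda>n. X n * Y n - X' n * Y' n)"
    by (simp add: algebra_simps)
  thus "padic_rel CARD('a) (\<lambda>n. X n * Y n) (\<lambda>n. X' n * Y' n)"
    using * by (simp add: padic_rel_def padic_cauchy_mult[OF prime_card])
qed

lift_definition inverse_padic :: "'a padic \<Rightarrow> 'a padic"
  is "\<lambda>X n. if padic_null CARD('a) X then 0 else inverse (X n)"
proof -
  fix X X' :: "nat \<Rightarrow> rat"
  assume *: "padic_rel CARD('a) X X'"
  show "padic_rel CARD('a) (\<lambda>n. if padic_null CARD('a) X then 0 else inverse (X n))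
      (\<lambda>n. if padic_null CARD('a) X' then 0 else inverse (X' n))"
  proof (cases "padic_null CARD('a) X")
    case True
    thus ?thesis using padic_rel_null_iff[OF prime_card *]
      by (simp add: padic_rel_refl padic_cauchy_const[OF prime_card])
  next
    case False
    thus ?thesis using padic_rel_null_iff[OF prime_card *] *
      by (simp add: padic_rel_def padic_cauchy_inverse[OF prime_card]
          padic_null_inverse_diff[OF prime_card])
  qed
qed

definition "x - y = x + - y" for x y :: "'a padic"

definition "x div y = x * inverse y" for x y :: "'a padic"

instance
proof
  note refl = padic_rel_refl padic_cauchy_const[OF prime_card] padic_cauchy_add[OF prime_card]
    padic_cauchy_mult[OF prime_card] padic_cauchy_minus[OF prime_card]
  note c = padic_rel_def
  fix a b c :: "'a padic"
  show "a + b = b + a" by transfer (simp add: padic_rel_def add.commute padic_null_zero[OF prime_card] refl)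
  show "(a + b) + c = a + (b + c)"
    by transfer (simp add: c add.assoc refl padic_null_zero[OF prime_card])
  show "0 + a = a" by transfer (simp add: c)
  show "- a + a = 0"
    by transfer (simp add: c refl padic_null_zero[OF prime_card])
  show "a - b = a + - b" by (rule minus_padic_def)
  show "(a * b) * c = a * (b * c)"
    by transfer (simp add: c mult.assoc refl padic_null_zero[OF prime_card])
  show "a * b = b * a"
    by transfer (simp add: c mult.commute refl padic_null_zero[OF prime_card])
  show "1 * a = a" by transfer (simp add: c)
  show "(a + b) * c = a * c + b * c"
    by transfer (simp add: c distrib_right refl padic_null_zero[OF prime_card])
  show "(0 :: 'a padic) \<noteq> 1"
    by transfer (simp add: c padic_null_minus[OF prime_card[where 'a = 'a], of "\<lambda>_. 1"] padic_null_const[OF prime_card])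
  show "a div b = a * inverse b" by (rule divide_padic_def)
  show "inverse (0 :: 'a padic) = 0"
    by transfer (simp add: c padic_null_zero[OF prime_card] refl)
  show "a \<noteq> 0 \<Longrightarrow> inverse a * a = 1"
  proof transfer
    fix X :: "nat \<Rightarrow> rat"
    assume X: "padic_rel CARD('a) X X" and "\<not> padic_rel CARD('a) X (\<lambda>_. 0)"
    hence cX: "padic_cauchy CARD('a) X" and nX: "\<not> padic_null CARD('a) X"
      by (auto simp: c refl)
    obtain x where "eventually (\<lambda>n. X n \<noteq> 0 \<and> rat_abs CARD('a) (X n) = rat_abs CARD('a) x) sequentially"
      using padic_cauchy_cases[OF prime_card cX] nX by (smt (verit) eventually_mono)
    hence "eventually (\<lambda>n. rat_abs CARD('a) (inverse (X n) * X n - 1) = 0) sequentially"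
      by eventually_elim (simp add: rat_abs_def)
    hence "padic_null CARD('a) (\<lambda>n. inverse (X n) * X n - 1)"
      unfolding padic_null_def by (rule tendsto_eventually)
    thus "padic_rel CARD('a) (\<lambda>n. (if padic_null CARD('a) X then 0 else inverse (X n)) * X n) (\<lambda>_. 1)"
      using cX nX by (simp add: c refl padic_cauchy_inverse[OF prime_card])
  qed
qed

end

lemma of_nat_padic: "(of_nat k :: 'p::prime_card padic) = Padic (\<lambda>_. of_nat k)"
proof (induction k)
  case 0
  show ?case by (simp add: zero_padic.abs_eq)
next
  case (Suc k)
  thus ?case
    by (simp add: one_padic.abs_eq plus_padic.abs_eq padic_rel_refl padic_cauchy_const[OF prime_card])
qed

lemma Padic_const_eq_iff: "(Padic (\<lambda>_. x) :: 'p::prime_card padic) = Padic (\<lambda>_. y) \<longleftrightarrow> x = y"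
  using Quotient_rel[OF Quotient_padic[where 'p = 'p], of "\<lambda>_. x" "\<lambda>_. y"]
  by (simp add: padic_rel_def padic_cauchy_const[OF prime_card] padic_null_const[OF prime_card])

instance padic :: (prime_card) field_char_0
proof
  show "inj (of_nat :: nat \<Rightarrow> 'a padic)"
    by (rule injI) (simp add: of_nat_padic Padic_const_eq_iff)
qed

lemma of_rat_padic: "(of_rat x :: 'p::prime_card padic) = Padic (\<lambda>_. x)"
proof -
  have i: "(of_int k :: 'p padic) = Padic (\<lambda>_. of_int k)" for k
    by (cases k) (simp_all add: of_nat_padic uminus_padic.abs_eq padic_rel_refl
        padic_cauchy_const[OF prime_card] del: of_nat_Suc)
  obtain a b :: int where ab: "b \<noteq> 0" "x = of_int a / of_int b"
    using quotient_of_div[of x] quotient_of_denom_pos[of x] by (metis less_irrefl surj_pair)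
  have "Padic (\<lambda>_. x) * (of_int b :: 'p padic) = of_int a"
    using ab by (simp add: i times_padic.abs_eq padic_rel_refl padic_cauchy_const[OF prime_card])
  hence "Padic (\<lambda>_. x) = (of_int a / of_int b :: 'p padic)"
    using ab(1) by (simp add: field_simps)
  thus ?thesis using ab by (simp add: of_rat_divide)
qed

text \<open>
  Along a Cauchy sequence of rationals the valuation is eventually constant, or tends to infinity.
\<close>

lift_definition padic_ord :: "'p::prime_card padic \<Rightarrow> ereal"
  is "\<lambda>X. lim (\<lambda>n. rat_eord CARD('p) (X n))"
  by (rule rat_eord_lim_eq[OF prime_card])

lemma padic_ord_of_rat: "padic_ord (of_rat x :: 'p::prime_card padic) = rat_eord CARD('p) x"
  by (simp add: of_rat_padic padic_ord.abs_eq padic_rel_refl padic_cauchy_const[OF prime_card])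

lemma padic_ord_cases:
  fixes x :: "'p::prime_card padic"
  obtains "x = 0" "padic_ord x = \<infinity>" | k where "x \<noteq> 0" "padic_ord x = ereal (of_int k)"
proof -
  have "x = 0 \<and> padic_ord x = \<infinity> \<or> x \<noteq> 0 \<and> (\<exists>k::int. padic_ord x = ereal (of_int k))"
  proof transfer
    fix X assume "padic_rel CARD('p) X X"
    hence "padic_cauchy CARD('p) X" by (simp add: padic_rel_def)
    from rat_eord_lim_cases[OF prime_card this] and this
    show "padic_rel CARD('p) X (\<lambda>_. 0) \<and> lim (\<lambda>n. rat_eord CARD('p) (X n)) = \<infinity> \<or>
      \<not> padic_rel CARD('p) X (\<lambda>_. 0) \<and> (\<exists>k::int. lim (\<lambda>n. rat_eord CARD('p) (X n)) = ereal (of_int k))"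
      by (auto simp: padic_rel_def padic_cauchy_const[OF prime_card] dest: limI)
  qed
  thus ?thesis using that by blast
qed

lemma padic_ord_0 [simp]: "padic_ord 0 = \<infinity>"
  using padic_ord_cases[of 0] by auto

lemma padic_ord_minus [simp]: "padic_ord (- x :: 'p::prime_card padic) = padic_ord x"
proof transfer
  fix X :: "nat \<Rightarrow> rat"
  have "rat_eord CARD('p) (- X n) = rat_eord CARD('p) (X n)" for n
    using rat_ord_minus[OF prime_card[where 'a = 'p], of "X n"] by (simp add: rat_eord_def)
  thus "lim (\<lambda>n. rat_eord CARD('p) (- X n)) = lim (\<lambda>n. rat_eord CARD('p) (X n))" by simp
qed

lemma padic_ord_add: "min (padic_ord x) (padic_ord y) \<le> padic_ord (x + y)"
  by transfer (rule rat_eord_add_lim[OF prime_card], simp_all add: padic_rel_def)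

definition padic_abs :: "'p::prime_card padic \<Rightarrow> real" where
  "padic_abs x = (if x = 0 then 0 else real CARD('p) powr (- real_of_ereal (padic_ord x)))"

lemma padic_abs_minus: "padic_abs (- x) = padic_abs x"
  by (simp add: padic_abs_def)

lemma padic_abs_triangle:
  fixes x y :: "'p::prime_card padic"
  shows "padic_abs (x + y) \<le> padic_abs x + padic_abs y"
proof (cases "x = 0 \<or> y = 0 \<or> x + y = 0")
  case False
  then obtain k l m where
    "padic_ord x = ereal (of_int k)" "padic_ord y = ereal (of_int l)" "padic_ord (x + y) = ereal (of_int m)"
    using padic_ord_cases by metis
  moreover from this have "min k l \<le> m"
    using padic_ord_add[of x y] by (auto simp: min_def split: if_splits)
  moreover have "real CARD('p) > 1" using p_gt_1[OF prime_card] .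
  ultimately have "padic_abs (x + y) \<le> padic_abs x \<or> padic_abs (x + y) \<le> padic_abs y"
    using False by (auto simp: padic_abs_def min_def split: if_splits)
  moreover have "padic_abs x \<ge> 0" "padic_abs y \<ge> 0" by (simp_all add: padic_abs_def)
  ultimately show ?thesis by linarith
qed (auto simp: padic_abs_def)

instantiation padic :: (prime_card) metric_space
begin

definition dist_padic :: "'a padic \<Rightarrow> 'a padic \<Rightarrow> real" where
  "dist_padic x y = padic_abs (x - y)"

definition uniformity_padic :: "('a padic \<times> 'a padic) filter" where
  "uniformity_padic = (INF e\<in>{0<..}. principal {(x, y). dist x y < e})"

definition open_padic :: "'a padic set \<Rightarrow> bool" where
  "open_padic U \<longleftrightarrow> (\<forall>x\<in>U. eventually (\<lambda>(x', y). x' = x \<longrightarrow> y \<in> U) uniformity)"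

instance
proof
  fix x y z :: "'a padic"
  show "dist x y = 0 \<longleftrightarrow> x = y"
    using p_gt_1[OF prime_card[where 'a = 'a]] by (simp add: dist_padic_def padic_abs_def)
  show "dist x y \<le> dist x z + dist y z"
    using padic_abs_triangle[of "x - z" "z - y"] padic_abs_minus[of "y - z"]
    by (simp add: dist_padic_def)
qed (simp_all add: uniformity_padic_def open_padic_def)

end

definition padic_integers :: "'p::prime_card padic set" where
  "padic_integers = {x. padic_ord x \<ge> 0}"

definition padic_max_ideal :: "'p::prime_card padic set" where
  "padic_max_ideal = (\<lambda>z. of_nat CARD('p) * z) ` padic_integers"


section \<open>Linear fractional transformations and continued fraction systems\<close>

text \<open>
  The dimension \<open>m\<close> is the cardinality of the finite index type \<open>'m\<close>, which takes the place of
  \<open>{1,\<dots>,m}\<close>. Vectors are functions on \<open>'m\<close>; the topology on them is the product topology.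
\<close>

definition indep_vectors :: "('m::finite \<Rightarrow> 'p::prime_card padic) set" (\<open>D\<^sub>m\<close>) where
  "D\<^sub>m = {x. \<forall>(c\<^sub>0::int) (c::'m \<Rightarrow> int).
     of_int c\<^sub>0 * 1 + (\<Sum>k\<in>UNIV. of_int (c k) * x k) = 0 \<longrightarrow> c\<^sub>0 = 0 \<and> (\<forall>k. c k = 0)}"

definition indep_vectors_max_ideal :: "('m::finite \<Rightarrow> 'p::prime_card padic) set" (\<open>D\<^sub>m''\<close>) where
  "D\<^sub>m' = D\<^sub>m \<inter> {x. \<forall>k. x k \<in> padic_max_ideal}"

definition lft :: "'m \<Rightarrow> ('m \<Rightarrow> 'm) \<Rightarrow> ('m \<Rightarrow> rat) \<Rightarrow> ('m \<Rightarrow> rat)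
    \<Rightarrow> ('m::finite \<Rightarrow> 'p::prime_card padic) \<Rightarrow> ('m \<Rightarrow> 'p padic)" where
  "lft i \<sigma> P Q x = (\<lambda>k. if k = inv \<sigma> i then of_rat (P k) / x i - of_rat (Q k)
                       else of_rat (P k) * x (\<sigma> k) / x i - of_rat (Q k))"

definition has_lft_parameter :: "(('m::finite \<Rightarrow> 'p::prime_card padic) \<Rightarrow> ('m \<Rightarrow> 'p padic))
    \<Rightarrow> 'm \<Rightarrow> ('m \<Rightarrow> 'm) \<Rightarrow> ('m \<Rightarrow> rat) \<Rightarrow> ('m \<Rightarrow> rat) \<Rightarrow> bool" where
  "has_lft_parameter F i \<sigma> P Q \<longleftrightarrow> bij \<sigma> \<and> (\<forall>k. P k \<noteq> 0) \<and> (\<forall>x\<in>D\<^sub>m. F x = lft i \<sigma> P Q x)"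

definition hyperbolic_parameter :: "'p::prime_card itself
    \<Rightarrow> 'm::finite \<Rightarrow> ('m \<Rightarrow> 'm) \<Rightarrow> ('m \<Rightarrow> rat) \<Rightarrow> ('m \<Rightarrow> rat) \<Rightarrow> bool" where
  "hyperbolic_parameter _ i \<sigma> P Q \<longleftrightarrow>
    (let s = inv \<sigma> i; ord = (\<lambda>r. padic_ord (of_rat r :: 'p padic)) in
      (\<forall>k. P k \<noteq> 0 \<and> ord (P k) \<ge> 0) \<and>
      (ord (Q s) \<le> 0 \<and> ord (P s / Q s) > 0) \<and>
      (\<forall>k. k \<noteq> s \<and> ord (Q k) \<le> 0 \<longrightarrow> ord (P s / Q s) - ord (P k / Q k) > 0) \<and>
      (\<forall>k. k \<noteq> s \<and> ord (Q k) > 0 \<longrightarrow> ord (P s / Q s) - ord (P k) > 0))"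

definition hyperbolic_lft :: "(('m::finite \<Rightarrow> 'p::prime_card padic) \<Rightarrow> ('m \<Rightarrow> 'p padic)) \<Rightarrow> bool" where
  "hyperbolic_lft F \<longleftrightarrow>
    (\<exists>i \<sigma> P Q. has_lft_parameter F i \<sigma> P Q \<and> hyperbolic_parameter TYPE('p) i \<sigma> P Q)"

text \<open>
  A linear fractional transformation is a map on \<open>D\<^sub>m\<close>; the values of the total function outside
  \<open>D\<^sub>m\<close> are irrelevant, so preimages are intersected with \<open>D\<^sub>m\<close>.
\<close>

definition lft_cell :: "(('m::finite \<Rightarrow> 'p::prime_card padic) \<Rightarrow> ('m \<Rightarrow> 'p padic))
    \<Rightarrow> ('m \<Rightarrow> 'p padic) set" where
  "lft_cell F = F -` D\<^sub>m' \<inter> D\<^sub>m"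

definition continued_fraction_system ::
    "'l set \<Rightarrow> ('l \<Rightarrow> ('m::finite \<Rightarrow> 'p::prime_card padic) \<Rightarrow> ('m \<Rightarrow> 'p padic)) \<Rightarrow> bool" where
  "continued_fraction_system \<Lambda> F \<longleftrightarrow>
    countable \<Lambda> \<and> (\<forall>l\<in>\<Lambda>. hyperbolic_lft (F l)) \<and>
    disjoint_family_on (\<lambda>l. lft_cell (F l)) \<Lambda> \<and> (\<Union>l\<in>\<Lambda>. lft_cell (F l)) = D\<^sub>m'"

text \<open>Only the values on \<open>D\<^sub>m'\<close>, where the index is unique, are meaningful.\<close>

definition cf_map :: "'l set \<Rightarrow> ('l \<Rightarrow> ('m::finite \<Rightarrow> 'p::prime_card padic) \<Rightarrow> ('m \<Rightarrow> 'p padic))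
    \<Rightarrow> ('m \<Rightarrow> 'p padic) \<Rightarrow> ('m \<Rightarrow> 'p padic)" where
  "cf_map \<Lambda> F x = F (THE l. l \<in> \<Lambda> \<and> x \<in> lft_cell (F l)) x"


section \<open>Haar measure\<close>

text \<open>
  Finiteness on compact sets and regularity need not be demanded separately: the former follows
  from the normalization, since the balls below are open, and the latter is automatic for such
  measures on this separable, locally compact metric space.
\<close>

definition normalized_haar :: "'p::prime_card padic measure \<Rightarrow> bool" where
  "normalized_haar \<mu> \<longleftrightarrow>
    sets \<mu> = sets borel \<and>
    (\<forall>a. distr \<mu> borel (\<lambda>x. a + x) = \<mu>) \<and>
    (\<forall>a\<in>padic_integers. \<forall>n\<ge>1.
       emeasure \<mu> ((\<lambda>z. of_nat CARD('p) * a + of_nat CARD('p) ^ n * z) ` padic_integers)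
       = ennreal (real CARD('p) powi (- (int n - 1))))"

definition haar_power :: "'p::prime_card padic measure \<Rightarrow> ('m::finite \<Rightarrow> 'p padic) measure" where
  "haar_power \<mu> = (\<Pi>\<^sub>M k\<in>UNIV. restrict_space \<mu> padic_max_ideal)"

end

theory Submission
  imports Defs
begin

text \<open>
  On \<open>(p\<int>\<^sub>p)\<^sup>m\<close> the inverse of a hyperbolic transformation is defined everywhere, maps into
  \<open>(p\<int>\<^sub>p)\<^sup>m\<close>, and contracts the maximum norm by the factor \<open>1/p\<close>. Moreover the images of two
  cubes of equal size differ by a translation. So the pull-back of Haar measure to
  \<open>(p\<int>\<^sub>p)\<^sup>m\<close> gives equal mass to cubes of equal size and is a multiple of Haar measure; no
  Jacobian has to be computed. Since the complement of \<open>D\<^sub>m\<close> is null, being a countable union of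
  rational hyperplanes, every branch maps its cell onto \<open>D\<^sub>m'\<close> with constant density. The cells are
  therefore independent under \<open>T\<close>, as in a Bernoulli shift: the preimage \<open>T\<^sup>-\<^sup>n A\<close> is independent
  of every cylinder of length at most \<open>n\<close>. By the contraction the cylinders generate the Borel sets, and
  the sets \<open>B\<close> for which the limit formula holds form a Dynkin system.
\<close>

section \<open>The absolute value\<close>

text \<open>Write u, w for the parameters of a branch and R for |u_s / w_s|. Hyperbolicity says that
  |w_s| >= 1, that R < 1, and that R * max 1 |w_k| < |u_k| for k other than s. As |w_s| exceeds
  every absolute value occurring in p Z_p, a preimage of a point of the box has |x_i| = R exactly,
  and on this sphere the inversion of x_i is a similarity. This is what makes a branch nearly
  affine. The strict inequalities yield the factor 1/p because nonzero absolute values are powers of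
  p; so the contraction is uniform even if \<Lambda> is infinite. The obstacle is that
  \<open>D\<^sub>m\<close> contains no cube, since every cube contains rational points. Each branch
  is therefore studied on a larger set \<open>V\<close> in the box, defined without linear
  independence, and \<open>D\<^sub>m\<close> enters only at the end, through the removal of a null
  set.\<close>

lemma padic_cases [cases type: padic]:
  fixes x :: "'p::prime_card padic"
  obtains X where "x = Padic X" "padic_cauchy CARD('p) X"
proof
  show "x = Padic (padic_repr x)"
    using Quotient_abs_rep[OF Quotient_padic] by metis
  show "padic_cauchy CARD('p) (padic_repr x)"
    using Quotient_rep_reflp[OF Quotient_padic, of x] by (simp add: padic_rel_def)
qed

text \<open>Along a Cauchy sequence the rational absolute values tend to 0 or are eventually
  constant, so the absolute value defined through \<open>padic_ord\<close> is the continuous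
  extension of \<open>rat_abs\<close>. Multiplicativity then passes to the limit.\<close>

lemma rat_abs_tendsto_padic_abs:
  assumes "padic_cauchy CARD('p::prime_card) X"
  shows "(\<lambda>n. rat_abs CARD('p) (X n)) \<longlonglongrightarrow> padic_abs (Padic X :: 'p padic)"
  using prime_card assms
proof (cases rule: padic_cauchy_cases)
  case 1
  hence "Padic X = (Padic (\<lambda>_. 0) :: 'p padic)"
    using assms Quotient_rel_abs[OF Quotient_padic[where 'p = 'p], of X "\<lambda>_. 0"]
    by (simp add: padic_rel_def padic_cauchy_const[OF prime_card])
  hence "(Padic X :: 'p padic) = 0" by (simp add: zero_padic.abs_eq)
  thus ?thesis using 1 by (simp add: padic_null_def padic_abs_def)
next
  case (2 x)
  have "(\<lambda>n. rat_eord CARD('p) (X n)) \<longlonglongrightarrow> rat_eord CARD('p) x"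
    using 2 by (intro rat_eord_tendsto_const[OF prime_card]) (auto elim: eventually_mono)
  hence ord: "padic_ord (Padic X :: 'p padic) = rat_ord CARD('p) x"
    using 2(1) assms by (simp add: padic_ord.abs_eq padic_rel_refl limI rat_eord_def)
  moreover from ord have "(Padic X :: 'p padic) \<noteq> 0" by auto
  ultimately have "padic_abs (Padic X :: 'p padic) = rat_abs CARD('p) x"
    using 2(1) p_gt_1[OF prime_card[where 'a = 'p]]
    by (simp add: padic_abs_def rat_abs_def powr_real_of_int' flip: of_int_minus)
  moreover have "eventually (\<lambda>n. rat_abs CARD('p) (X n) = rat_abs CARD('p) x) sequentially"
    using 2(3) by (auto elim: eventually_mono)
  ultimately show ?thesis by (simp add: tendsto_eventually)
qed

lemma padic_abs_of_rat: "padic_abs (of_rat x :: 'p::prime_card padic) = rat_abs CARD('p) x"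
  using LIMSEQ_unique[OF rat_abs_tendsto_padic_abs[OF padic_cauchy_const[OF prime_card]] tendsto_const]
  by (simp add: of_rat_padic)

lemma padic_abs_nonneg [simp]: "padic_abs x \<ge> 0"
  by (simp add: padic_abs_def)

lemma padic_abs_eq_0_iff [simp]: "padic_abs (x :: 'p::prime_card padic) = 0 \<longleftrightarrow> x = 0"
  using p_gt_1[OF prime_card[where 'a = 'p]] by (simp add: padic_abs_def)

lemma padic_abs_pos_iff [simp]: "padic_abs (x :: 'p::prime_card padic) > 0 \<longleftrightarrow> x \<noteq> 0"
  using padic_abs_nonneg[of x] padic_abs_eq_0_iff[of x] by linarith

lemma padic_abs_0 [simp]: "padic_abs 0 = 0"
  by (simp add: padic_abs_def)

lemma padic_abs_mult: "padic_abs (x * y) = padic_abs x * padic_abs (y :: 'p::prime_card padic)"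
proof (cases x; cases y)
  fix X Y
  assume X: "x = Padic X" "padic_cauchy CARD('p) X" and Y: "y = Padic Y" "padic_cauchy CARD('p) Y"
  have "x * y = Padic (\<lambda>n. X n * Y n)"
    using X Y by (simp add: times_padic.abs_eq padic_rel_refl)
  hence "(\<lambda>n. rat_abs CARD('p) (X n * Y n)) \<longlonglongrightarrow> padic_abs (x * y)"
    using X Y padic_cauchy_mult[OF prime_card[where 'a = 'p]] by (simp add: rat_abs_tendsto_padic_abs)
  moreover have "(\<lambda>n. rat_abs CARD('p) (X n) * rat_abs CARD('p) (Y n)) \<longlonglongrightarrow> padic_abs x * padic_abs y"
    using X Y by (intro tendsto_mult) (auto intro: rat_abs_tendsto_padic_abs)
  ultimately show ?thesis
    by (simp add: rat_abs_mult[OF prime_card] LIMSEQ_unique)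
qed

lemma padic_abs_1 [simp]: "padic_abs (1 :: 'p::prime_card padic) = 1"
  using padic_abs_of_rat[where 'p = 'p, of 1] by (simp add: rat_abs_1[OF prime_card])

lemma padic_abs_inverse: "padic_abs (inverse x) = inverse (padic_abs (x :: 'p::prime_card padic))"
proof (cases "x = 0")
  case False
  hence "padic_abs x * padic_abs (inverse x) = 1" by (simp flip: padic_abs_mult)
  thus ?thesis by (metis inverse_unique)
qed simp

lemma padic_abs_divide: "padic_abs (x / y) = padic_abs x / padic_abs (y :: 'p::prime_card padic)"
  by (simp add: divide_inverse padic_abs_mult padic_abs_inverse)

lemma padic_abs_power: "padic_abs (x ^ n) = padic_abs (x :: 'p::prime_card padic) ^ n"
  by (induction n) (simp_all add: padic_abs_mult)

lemma padic_abs_diff_commute: "padic_abs (x - y) = padic_abs (y - x :: 'p::prime_card padic)"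
  using padic_abs_minus[of "x - y"] by simp

text \<open>Bridge from \<open>ereal\<close> valuations, in which hyperbolicity and
  \<open>padic_integers\<close> are stated, to real inequalities. It also covers 0, whose valuation
  is infinite.\<close>

lemma padic_abs_less_iff_ord_less:
  fixes x y :: "'p::prime_card padic"
  shows "padic_abs x < padic_abs y \<longleftrightarrow> padic_ord y < padic_ord x"
  using p_gt_1[OF prime_card[where 'a = 'p]]
  by (cases x rule: padic_ord_cases; cases y rule: padic_ord_cases) (simp_all add: padic_abs_def)

lemma padic_abs_le_iff_ord_le:
  fixes x y :: "'p::prime_card padic"
  shows "padic_abs x \<le> padic_abs y \<longleftrightarrow> padic_ord y \<le> padic_ord x"
  using padic_abs_less_iff_ord_less[of y x] by (simp add: not_less[symmetric])

section \<open>The ultrametric inequality and its equality case\<close>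

lemma padic_abs_add_le:
  fixes x y :: "'p::prime_card padic"
  assumes "padic_abs x \<le> r" "padic_abs y \<le> r"
  shows "padic_abs (x + y) \<le> r"
  using padic_ord_add[of x y] assms padic_abs_le_iff_ord_le[of "x + y" x] padic_abs_le_iff_ord_le[of "x + y" y]
  by (auto simp: min_def split: if_splits)

lemma padic_abs_diff_le:
  fixes x y :: "'p::prime_card padic"
  assumes "padic_abs x \<le> r" "padic_abs y \<le> r"
  shows "padic_abs (x - y) \<le> r"
  using padic_abs_add_le[of x r "- y"] assms by (simp add: padic_abs_minus)

text \<open>The dominant term decides: as x = (x + y) - y and |y| < |x|, the ultrametric inequality
  leaves no room for |x + y| < |x|.\<close>

lemma padic_abs_add_eq:
  fixes x y :: "'p::prime_card padic"
  assumes "padic_abs y < padic_abs x"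
  shows "padic_abs (x + y) = padic_abs x"
proof (rule antisym)
  show "padic_abs (x + y) \<le> padic_abs x"
    using padic_abs_add_le[of x "padic_abs x" y] assms by simp
  show "padic_abs x \<le> padic_abs (x + y)"
    using padic_abs_diff_le[of "x + y" "max (padic_abs (x + y)) (padic_abs y)" y] assms
    by (auto simp del: max.bounded_iff)
qed

lemma padic_abs_powi:
  assumes "(x :: 'p::prime_card padic) \<noteq> 0"
  obtains k where "padic_abs x = real CARD('p) powi k"
proof -
  obtain k where "padic_ord x = ereal (of_int k)" using padic_ord_cases[of x] assms by metis
  hence "padic_abs x = real CARD('p) powi (- k)"
    using assms p_gt_1[OF prime_card[where 'a = 'p]]
    by (simp add: padic_abs_def powr_real_of_int' flip: of_int_minus)
  thus ?thesis using that by blast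
qed

text \<open>The nonzero values of the absolute value are powers of \<open>p\<close>.\<close>

lemma padic_abs_less_imp_le:
  fixes x y :: "'p::prime_card padic"
  assumes "padic_abs x < padic_abs y"
  shows "padic_abs x \<le> padic_abs y / real CARD('p)"
proof (cases "x = 0")
  case False
  have p: "real CARD('p) > 1" using p_gt_1[OF prime_card] .
  have "y \<noteq> 0" using assms padic_abs_nonneg[of x] by (auto simp: not_less[symmetric] simp del: padic_abs_nonneg)
  then obtain k l where kl: "padic_abs x = real CARD('p) powi k" "padic_abs y = real CARD('p) powi l"
    using padic_abs_powi False by metis
  hence "k < l" using assms p power_int_increasing[of l k "real CARD('p)"] by (force simp: not_less[symmetric])
  hence "real CARD('p) powi k \<le> real CARD('p) powi (l - 1)"
    using p by (intro power_int_increasing) auto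
  thus ?thesis using kl p by (simp add: power_int_diff)
qed simp

section \<open>The absolute value of p, and cosets of powers of p as balls\<close>

lemma padic_abs_of_nat_card: "padic_abs (of_nat CARD('p) :: 'p::prime_card padic) = 1 / real CARD('p)"
proof -
  have "prime (int CARD('p))" using prime_card by simp
  hence "multiplicity (int CARD('p)) (int CARD('p)) = 1"
    by (intro multiplicity_self) (auto simp: prime_gt_0_int dest: not_prime_unit)
  hence "rat_ord CARD('p) (of_int (int CARD('p)) / of_int 1) = 1"
    using prime_card[where 'a = 'p] by (subst rat_ord_divide[OF prime_card]) (auto)
  hence "rat_ord CARD('p) (of_nat CARD('p)) = 1" by simp
  moreover have "(of_nat CARD('p) :: 'p padic) = of_rat (of_nat CARD('p))" by simp
  ultimately show ?thesis
    by (simp only: padic_abs_of_rat) (simp add: rat_abs_def power_int_minus field_simps)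
qed

lemma padic_integers_eq: "padic_integers = {x :: 'p::prime_card padic. padic_abs x \<le> 1}"
proof -
  have "padic_ord (1 :: 'p padic) = 0"
    using padic_ord_of_rat[where 'p = 'p, of 1] by (simp add: rat_eord_def rat_ord_1[OF prime_card])
  thus ?thesis using padic_abs_le_iff_ord_le[of _ "1 :: 'p padic"]
    by (auto simp: padic_integers_def)
qed

text \<open>Converts the cosets on which \<open>normalized_haar\<close> prescribes the measure into
  balls: z is recovered as (x - a) / p^n, and dividing by p^n multiplies absolute values by
  p^n.\<close>

lemma mem_padic_ball_iff:
  fixes a x :: "'p::prime_card padic"
  shows "x \<in> (\<lambda>z. a + of_nat CARD('p) ^ n * z) ` padic_integers \<longleftrightarrow> padic_abs (x - a) \<le> 1 / real CARD('p) ^ n"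
proof -
  have p: "real CARD('p) > 0" "(of_nat CARD('p) :: 'p padic) \<noteq> 0"
    using p_gt_1[OF prime_card[where 'a = 'p]] by auto
  have "x \<in> (\<lambda>z. a + of_nat CARD('p) ^ n * z) ` padic_integers" if "padic_abs (x - a) \<le> 1 / real CARD('p) ^ n"
  proof (rule image_eqI)
    show "x = a + of_nat CARD('p) ^ n * ((x - a) / of_nat CARD('p) ^ n)" using p by simp
    show "(x - a) / of_nat CARD('p) ^ n \<in> padic_integers"
      using that p by (simp add: padic_integers_eq padic_abs_divide padic_abs_power padic_abs_of_nat_card field_simps)
  qed
  moreover have "padic_abs (x - a) \<le> 1 / real CARD('p) ^ n"
    if "x = a + of_nat CARD('p) ^ n * z" "padic_abs z \<le> 1" for z
    using that p by (simp add: padic_abs_mult padic_abs_power padic_abs_of_nat_card field_simps)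
  ultimately show ?thesis by (auto simp: padic_integers_eq)
qed

lemma padic_max_ideal_eq: "padic_max_ideal = {x :: 'p::prime_card padic. padic_abs x \<le> 1 / real CARD('p)}"
  using mem_padic_ball_iff[of _ 0 1] by (auto simp: padic_max_ideal_def)

section \<open>Topology of the field and of its powers\<close>

lemma tendsto_padic_iff:
  "(f \<longlongrightarrow> a) F \<longleftrightarrow> ((\<lambda>x. padic_abs (f x - a)) \<longlongrightarrow> 0) F"
  by (simp add: tendsto_dist_iff[of f] dist_padic_def)

lemma tendsto_padicI:
  assumes "eventually (\<lambda>x. padic_abs (f x - a) \<le> g x) F" "(g \<longlongrightarrow> 0) F"
  shows "(f \<longlongrightarrow> a) F"
  unfolding tendsto_padic_iff by (rule tendsto_sandwich[OF _ assms(1) tendsto_const assms(2)]) simp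

lemma tendsto_padic_add:
  fixes f g :: "'a \<Rightarrow> 'p::prime_card padic"
  assumes "(f \<longlongrightarrow> a) F" "(g \<longlongrightarrow> b) F"
  shows "((\<lambda>x. f x + g x) \<longlongrightarrow> a + b) F"
proof (rule tendsto_padicI)
  have "padic_abs (f x + g x - (a + b)) \<le> padic_abs (f x - a) + padic_abs (g x - b)" for x
    using padic_abs_triangle[of "f x - a" "g x - b"] by (simp add: algebra_simps)
  thus "\<forall>\<^sub>F x in F. padic_abs (f x + g x - (a + b)) \<le> padic_abs (f x - a) + padic_abs (g x - b)" by simp
  show "((\<lambda>x. padic_abs (f x - a) + padic_abs (g x - b)) \<longlongrightarrow> 0) F"
    using assms tendsto_add[of _ 0 F _ 0] by (fastforce simp: tendsto_padic_iff)
qed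

lemma tendsto_padic_mult:
  fixes f g :: "'a \<Rightarrow> 'p::prime_card padic"
  assumes "(f \<longlongrightarrow> a) F" "(g \<longlongrightarrow> b) F"
  shows "((\<lambda>x. f x * g x) \<longlongrightarrow> a * b) F"
proof (rule tendsto_padicI)
  have "padic_abs (f x * g x - a * b)
    \<le> padic_abs (f x - a) * padic_abs (g x - b) + padic_abs (f x - a) * padic_abs b + padic_abs a * padic_abs (g x - b)" for x
  proof -
    have "f x * g x - a * b = ((f x - a) * (g x - b) + (f x - a) * b) + a * (g x - b)"
      by (simp add: algebra_simps)
    also have "padic_abs \<dots> \<le> padic_abs ((f x - a) * (g x - b)) + padic_abs ((f x - a) * b) + padic_abs (a * (g x - b))"
      using padic_abs_triangle[of "(f x - a) * (g x - b) + (f x - a) * b" "a * (g x - b)"]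
        padic_abs_triangle[of "(f x - a) * (g x - b)" "(f x - a) * b"] by linarith
    finally show ?thesis by (simp add: padic_abs_mult)
  qed
  thus "\<forall>\<^sub>F x in F. padic_abs (f x * g x - a * b)
    \<le> padic_abs (f x - a) * padic_abs (g x - b) + padic_abs (f x - a) * padic_abs b + padic_abs a * padic_abs (g x - b)"
    by simp
  have "((\<lambda>x. padic_abs (f x - a) * padic_abs (g x - b) + padic_abs (f x - a) * padic_abs b + padic_abs a * padic_abs (g x - b))
      \<longlongrightarrow> 0 * 0 + 0 * padic_abs b + padic_abs a * 0) F"
    using assms by (intro tendsto_intros) (auto simp: tendsto_padic_iff)
  thus "((\<lambda>x. padic_abs (f x - a) * padic_abs (g x - b) + padic_abs (f x - a) * padic_abs b + padic_abs a * padic_abs (g x - b))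
      \<longlongrightarrow> 0) F" by simp
qed

lemma tendsto_padic_inverse:
  fixes f :: "'a \<Rightarrow> 'p::prime_card padic"
  assumes "(f \<longlongrightarrow> a) F" "a \<noteq> 0"
  shows "((\<lambda>x. inverse (f x)) \<longlongrightarrow> inverse a) F"
proof (rule tendsto_padicI)
  have lim: "((\<lambda>x. padic_abs (f x - a)) \<longlongrightarrow> 0) F" using assms(1) by (simp add: tendsto_padic_iff)
  have "\<forall>\<^sub>F x in F. padic_abs (f x - a) < padic_abs a"
    using lim assms(2) by (intro order_tendstoD) auto
  thus "\<forall>\<^sub>F x in F. padic_abs (inverse (f x) - inverse a) \<le> padic_abs (f x - a) / (padic_abs a * padic_abs a)"
  proof eventually_elim
    case (elim x)
    hence eq: "padic_abs (f x) = padic_abs a" using padic_abs_add_eq[of "f x - a" a] by simp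
    hence "f x \<noteq> 0" using assms(2) by auto
    hence "inverse (f x) - inverse a = - (f x - a) / (f x * a)"
      using assms(2) by (simp add: field_simps)
    thus ?case by (simp add: padic_abs_divide padic_abs_mult padic_abs_minus padic_abs_diff_commute eq)
  qed
  show "((\<lambda>x. padic_abs (f x - a) / (padic_abs a * padic_abs a)) \<longlongrightarrow> 0) F"
    using tendsto_divide[OF lim tendsto_const, of "padic_abs a * padic_abs a"] assms(2) by simp
qed

text \<open>Together with the next instance this supplies the continuity of sums, negatives and
  products on which \<open>continuous_intros\<close> relies for translations, hyperplanes and
  branches.\<close>

instance padic :: (prime_card) topological_ab_group_add
proof
  show "((\<lambda>x. fst x + snd x) \<longlongrightarrow> a + b) (nhds a \<times>\<^sub>F nhds b)" for a b :: "'a padic"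
    by (intro tendsto_padic_add filterlim_fst filterlim_snd)
  show "(uminus \<longlongrightarrow> - a) (nhds a)" for a :: "'a padic"
    using tendsto_padic_mult[of "\<lambda>_. -1" "-1" "nhds a" "\<lambda>x. x" a] filterlim_ident[of "nhds a"] by simp
qed

instance padic :: (prime_card) topological_comm_monoid_mult
proof
  show "((\<lambda>x. fst x * snd x) \<longlongrightarrow> a * b) (nhds a \<times>\<^sub>F nhds b)" for a b :: "'a padic"
    by (intro tendsto_padic_mult filterlim_fst filterlim_snd)
qed

lemma continuous_on_padic_inverse:
  fixes f :: "'a::topological_space \<Rightarrow> 'p::prime_card padic"
  assumes "continuous_on S f" "\<And>x. x \<in> S \<Longrightarrow> f x \<noteq> 0"
  shows "continuous_on S (\<lambda>x. inverse (f x))"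
  using assms unfolding continuous_on_def by (auto intro: tendsto_padic_inverse)

lemma rat_dense_padic:
  fixes x :: "'p::prime_card padic"
  assumes "e > 0"
  obtains q where "padic_abs (x - of_rat q) < e"
proof (cases x)
  fix X assume X: "x = Padic X" "padic_cauchy CARD('p) X"
  \<comment> \<open>Half of e, because only a weak inequality survives the limit.\<close>
  obtain k where k: "\<And>n. n \<ge> k \<Longrightarrow> rat_abs CARD('p) (X n - X k) < e / 2"
    using X(2) half_gt_zero[OF assms] unfolding padic_cauchy_def by blast
  have c: "padic_cauchy CARD('p) (\<lambda>n. X n - X k)"
    using padic_cauchy_add[OF prime_card X(2) padic_cauchy_const[OF prime_card], of "- X k"] by simp
  have "x - of_rat (X k) = Padic (\<lambda>n. X n - X k)"
    using X by (simp add: of_rat_padic minus_padic_def uminus_padic.abs_eq plus_padic.abs_eq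
        padic_rel_refl padic_cauchy_const[OF prime_card])
  hence "(\<lambda>n. rat_abs CARD('p) (X n - X k)) \<longlonglongrightarrow> padic_abs (x - of_rat (X k))"
    using rat_abs_tendsto_padic_abs[OF c] by simp
  moreover have "\<forall>\<^sub>F n in sequentially. rat_abs CARD('p) (X n - X k) \<le> e / 2"
    unfolding eventually_sequentially using k less_imp_le by blast
  ultimately have "padic_abs (x - of_rat (X k)) \<le> e / 2"
    by (rule tendsto_upperbound) simp
  thus ?thesis using that[of "X k"] assms by simp
qed

text \<open>Second countability allows countable covers by cubes to be extracted with
  \<open>Lindelof\<close>, and makes the product and Borel sigma-algebras agree. The basis consists
  of balls with rational centres.\<close>

instance padic :: (prime_card) second_countable_topology
proof
  define B :: "'a padic set set" where "B = (\<lambda>(q, n). ball (of_rat q) (inverse (real (Suc n)))) ` UNIV"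
  have "topological_basis B"
  proof (rule topological_basisI)
    show "open U" if "U \<in> B" for U using that by (auto simp: B_def)
    fix U :: "'a padic set" and x assume U: "open U" "x \<in> U"
    then obtain e where e: "e > 0" "ball x e \<subseteq> U" using open_contains_ball by blast
    obtain n where n: "inverse (real (Suc n)) < e / 2" using reals_Archimedean[of "e / 2"] e(1) by auto
    obtain q where q: "padic_abs (x - of_rat q) < inverse (real (Suc n))"
      using rat_dense_padic[of "inverse (real (Suc n))" x] by auto
    have "ball (of_rat q) (inverse (real (Suc n))) \<subseteq> ball x e"
    proof
      fix y :: "'a padic" assume "y \<in> ball (of_rat q) (inverse (real (Suc n)))"
      thus "y \<in> ball x e"
        using dist_triangle[of x y "of_rat q"] q n by (simp add: dist_padic_def)
    qed
    thus "\<exists>U'\<in>B. x \<in> U' \<and> U' \<subseteq> U"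
      using q e(2) by (intro bexI[of _ "ball (of_rat q) (inverse (real (Suc n)))"])
        (auto simp: B_def dist_padic_def padic_abs_diff_commute[of x])
  qed
  moreover have "countable B" by (simp add: B_def)
  ultimately show "\<exists>B :: 'a padic set set. countable B \<and> open = generate_topology B"
    using topological_basis_imp_subbasis by blast
qed

section \<open>Cubes, the balls of the maximum norm\<close>

definition max_ideal_box :: "('m::finite \<Rightarrow> 'p::prime_card padic) set" where
  "max_ideal_box = {x. \<forall>k. x k \<in> padic_max_ideal}"

definition padic_cube :: "('m::finite \<Rightarrow> 'p::prime_card padic) \<Rightarrow> nat \<Rightarrow> ('m \<Rightarrow> 'p padic) set" where
  "padic_cube a n = {x. \<forall>k. padic_abs (x k - a k) \<le> 1 / real CARD('p) ^ n}"

lemma max_ideal_box_eq_cube: "max_ideal_box = padic_cube (\<lambda>_. 0) 1"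
  by (simp add: max_ideal_box_def padic_cube_def padic_max_ideal_eq)

lemma padic_cube_refl [simp]: "a \<in> padic_cube a n"
  by (simp add: padic_cube_def)

lemma padic_cube_add:
  "x \<in> padic_cube a n \<Longrightarrow> y \<in> padic_cube b n \<Longrightarrow> (\<lambda>k. x k + y k) \<in> padic_cube (\<lambda>k. a k + b k) n"
  using padic_abs_add_le[of "x k - a k" _ "y k - b k" for k] by (simp add: padic_cube_def algebra_simps)

lemma padic_cube_diff:
  "x \<in> padic_cube a n \<Longrightarrow> y \<in> padic_cube b n \<Longrightarrow> (\<lambda>k. x k - y k) \<in> padic_cube (\<lambda>k. a k - b k) n"
  using padic_abs_diff_le[of "x k - a k" _ "y k - b k" for k] by (simp add: padic_cube_def algebra_simps)

lemma max_ideal_box_add: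
  "x \<in> max_ideal_box \<Longrightarrow> y \<in> max_ideal_box \<Longrightarrow> (\<lambda>k. x k + y k) \<in> max_ideal_box"
  using padic_cube_add[of x "\<lambda>_. 0" 1 y "\<lambda>_. 0"] by (simp add: max_ideal_box_eq_cube)

lemma max_ideal_box_diff:
  "x \<in> max_ideal_box \<Longrightarrow> y \<in> max_ideal_box \<Longrightarrow> (\<lambda>k. x k - y k) \<in> max_ideal_box"
  using padic_cube_diff[of x "\<lambda>_. 0" 1 y "\<lambda>_. 0"] by (simp add: max_ideal_box_eq_cube)

text \<open>Every point of an ultrametric ball is a centre of it. Hence cubes of equal level
  coincide or are disjoint.\<close>

lemma padic_cube_eq:
  assumes "b \<in> padic_cube a n"
  shows "padic_cube b n = padic_cube a n"
proof -
  have "x \<in> padic_cube b n \<longleftrightarrow> x \<in> padic_cube a n" for x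
    using padic_cube_add[of x b n b a] padic_cube_diff[of x a n b a] assms
    by (auto simp: padic_cube_def algebra_simps dest: padic_abs_add_le padic_abs_diff_le)
  thus ?thesis by blast
qed

lemma padic_cube_mono:
  assumes "n \<le> l"
  shows "padic_cube a l \<subseteq> padic_cube (a :: 'm::finite \<Rightarrow> 'p::prime_card padic) n"
proof -
  have "1 / real CARD('p) ^ l \<le> 1 / real CARD('p) ^ n"
    using assms p_gt_1[OF prime_card[where 'a = 'p]] by (intro divide_left_mono power_increasing) auto
  thus ?thesis by (auto simp: padic_cube_def intro: order.trans)
qed

lemma padic_cube_subset_box: "a \<in> max_ideal_box \<Longrightarrow> n \<ge> 1 \<Longrightarrow> padic_cube a n \<subseteq> max_ideal_box"
  using padic_cube_mono[of 1 n a] padic_cube_eq[of a "\<lambda>_. 0" 1] by (simp add: max_ideal_box_eq_cube)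

text \<open>A common point serves as centre of both cubes, and concentric cubes are nested.\<close>

lemma padic_cubes_nested:
  assumes "padic_cube a n \<inter> padic_cube b l \<noteq> {}"
  shows "padic_cube a n \<inter> padic_cube b l \<in> {padic_cube a n, padic_cube b l}"
proof -
  obtain c where c: "c \<in> padic_cube a n" "c \<in> padic_cube b l" using assms by blast
  thus ?thesis
    using padic_cube_mono[of n l c] padic_cube_mono[of l n c] padic_cube_eq[of c a n] padic_cube_eq[of c b l]
    by (cases "n \<le> l") auto
qed

lemma open_padic_cball:
  fixes a :: "'p::prime_card padic"
  shows "open {x. padic_abs (x - a) \<le> 1 / real CARD('p) ^ n}"
  unfolding open_contains_ball
proof
  fix x assume x: "x \<in> {x. padic_abs (x - a) \<le> 1 / real CARD('p) ^ n}"
  \<comment> \<open>By the ultrametric inequality a ball of the same radius around any member stays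
    inside.\<close>
  have "ball x (1 / real CARD('p) ^ n) \<subseteq> {x. padic_abs (x - a) \<le> 1 / real CARD('p) ^ n}"
  proof
    fix y assume "y \<in> ball x (1 / real CARD('p) ^ n)"
    thus "y \<in> {x. padic_abs (x - a) \<le> 1 / real CARD('p) ^ n}"
      using padic_abs_add_le[of "y - x" "1 / real CARD('p) ^ n" "x - a"] x
      by (simp add: dist_padic_def padic_abs_diff_commute[of x])
  qed
  thus "\<exists>e>0. ball x e \<subseteq> {x. padic_abs (x - a) \<le> 1 / real CARD('p) ^ n}"
    using p_gt_1[OF prime_card[where 'a = 'p]] by (intro exI[of _ "1 / real CARD('p) ^ n"]) auto
qed

lemma open_padic_cube: "open (padic_cube (a :: 'm::finite \<Rightarrow> 'p::prime_card padic) n)"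
  using product_topology_basis'[of UNIV "\<lambda>k. {x. padic_abs (x - a k) \<le> 1 / real CARD('p) ^ n}" "\<lambda>k. k"]
  by (simp add: open_padic_cball padic_cube_def)

lemma open_contains_padic_cube:
  fixes U :: "('m::finite \<Rightarrow> 'p::prime_card padic) set"
  assumes "open U" "x \<in> U"
  obtains n where "n \<ge> 1" "padic_cube x n \<subseteq> U"
proof -
  have "openin (product_topology (\<lambda>_. euclidean) UNIV) U" using assms(1) by (simp add: open_fun_def)
  from product_topology_open_contains_basis[OF this assms(2)]
  obtain S where S: "x \<in> Pi\<^sub>E UNIV S" "\<And>k. open (S k)" "Pi\<^sub>E UNIV S \<subseteq> U" by (auto simp flip: open_openin)
  have p: "real CARD('p) > 1" by (rule p_gt_1[OF prime_card])
  have "\<exists>n. {y. padic_abs (y - x k) \<le> 1 / real CARD('p) ^ n} \<subseteq> S k" for k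
  proof -
    have "x k \<in> S k" using S(1) by (simp add: PiE_iff)
    then obtain e where e: "e > 0" "ball (x k) e \<subseteq> S k" using S(2) open_contains_ball by blast
    obtain n where n: "(1 / real CARD('p)) ^ n < e" using real_arch_pow_inv[of e "1 / real CARD('p)"] e(1) p by auto
    have "{y. padic_abs (y - x k) \<le> 1 / real CARD('p) ^ n} \<subseteq> ball (x k) e"
      using n by (auto simp: dist_padic_def padic_abs_diff_commute[of "x k"] power_one_over)
    thus ?thesis using e(2) by blast
  qed
  then obtain n where n: "\<And>k. {y. padic_abs (y - x k) \<le> 1 / real CARD('p) ^ n k} \<subseteq> S k" by metis
  \<comment> \<open>The index type is finite, so the finest of the coordinate levels serves all
    coordinates. \<open>Suc\<close> secures N \<ge> 1, as cubes of level 0 do not fit into the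
    box.\<close>
  define N where "N = Suc (Max (range n))"
  have "padic_cube x N \<subseteq> Pi\<^sub>E UNIV S"
  proof
    fix y assume y: "y \<in> padic_cube x N"
    have "y k \<in> S k" for k
    proof -
      have "n k \<le> N" unfolding N_def using Max_ge[of "range n" "n k"] by (simp add: le_SucI)
      hence "y \<in> padic_cube x (n k)" using padic_cube_mono[of "n k" N x] y by blast
      thus ?thesis using n[of k] by (auto simp: padic_cube_def)
    qed
    thus "y \<in> Pi\<^sub>E UNIV S" by (simp add: PiE_UNIV_domain)
  qed
  thus ?thesis using that[of N] S(3) by (auto simp: N_def)
qed

lemma open_max_ideal_box: "open max_ideal_box"
  by (simp add: max_ideal_box_eq_cube open_padic_cube)

section \<open>Haar measure on cubes\<close>

text \<open>Measurability of the identity map extends the condition from traces of open sets to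
  traces of Borel sets. The uses are the box with its cubes, and \<open>D\<^sub>m'\<close>, which is
  not open, with the cylinders.\<close>

lemma sets_restrict_borel_eq_sigma_sets:
  fixes G :: "'a::topological_space set set"
  assumes "G \<subseteq> sets (restrict_space borel \<Omega>)"
    and "\<And>S. open S \<Longrightarrow> S \<inter> \<Omega> \<in> sigma_sets \<Omega> G"
  shows "sets (restrict_space borel \<Omega>) = sigma_sets \<Omega> G"
proof
  have G: "G \<subseteq> Pow \<Omega>" using assms(1) by (auto simp: sets_restrict_space)
  have meas: "(\<lambda>x. x) \<in> borel_measurable (sigma \<Omega> G)"
    using assms(2) G by (intro borel_measurableI) simp
  have "A \<inter> \<Omega> \<in> sigma_sets \<Omega> G" if "A \<in> sets borel" for A
    using measurable_sets[OF meas that] G by simp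
  thus "sets (restrict_space borel \<Omega>) \<subseteq> sigma_sets \<Omega> G"
    by (auto simp: sets_restrict_space Int_commute)
  show "sigma_sets \<Omega> G \<subseteq> sets (restrict_space borel \<Omega>)"
    using sets.sigma_sets_subset[OF assms(1)] by (simp add: space_restrict_space)
qed

lemma Union_open_in_sigma_sets:
  fixes U :: "'a::second_countable_topology set"
  assumes "\<And>x. x \<in> U \<Longrightarrow> \<exists>C\<in>G. open C \<and> x \<in> C \<and> C \<subseteq> U"
  shows "U \<in> sigma_sets \<Omega> G"
proof -
  have "\<And>S. S \<in> {C \<in> G. open C \<and> C \<subseteq> U} \<Longrightarrow> open S" by simp
  then obtain F where F: "F \<subseteq> {C \<in> G. open C \<and> C \<subseteq> U}" "countable F" "\<Union>F = \<Union>{C \<in> G. open C \<and> C \<subseteq> U}"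
    using Lindelof by blast
  have "\<Union>{C \<in> G. open C \<and> C \<subseteq> U} = U" using assms by blast
  hence "\<Union>F = U" using F(3) by simp
  moreover have "\<Union>F \<in> sigma_sets \<Omega> G"
    using F by (intro sigma_sets_UNION) (auto intro: sigma_sets.Basic)
  ultimately show ?thesis by simp
qed

definition padic_cubes :: "('m::finite \<Rightarrow> 'p::prime_card padic) set set" where
  "padic_cubes = {padic_cube a n |a n. a \<in> max_ideal_box \<and> n \<ge> 1}"

lemma sets_restrict_max_ideal_box:
  "sets (restrict_space borel (max_ideal_box :: ('m::finite \<Rightarrow> 'p::prime_card padic) set))
    = sigma_sets max_ideal_box (insert {} padic_cubes)"
proof (rule sets_restrict_borel_eq_sigma_sets)
  show "insert {} padic_cubes \<subseteq> sets (restrict_space borel (max_ideal_box :: ('m \<Rightarrow> 'p padic) set))"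
  proof
    fix C :: "('m \<Rightarrow> 'p padic) set" assume "C \<in> insert {} padic_cubes"
    hence "open C" "C \<subseteq> max_ideal_box"
      using padic_cube_subset_box open_padic_cube open_empty unfolding padic_cubes_def by blast+
    thus "C \<in> sets (restrict_space borel max_ideal_box)"
      by (simp add: sets_restrict_space_iff open_max_ideal_box)
  qed
  fix S :: "('m \<Rightarrow> 'p padic) set" assume "open S"
  show "S \<inter> max_ideal_box \<in> sigma_sets max_ideal_box (insert {} padic_cubes)"
  proof (rule Union_open_in_sigma_sets)
    fix x assume x: "x \<in> S \<inter> max_ideal_box"
    then obtain n where "n \<ge> 1" "padic_cube x n \<subseteq> S"
      using open_contains_padic_cube[OF \<open>open S\<close>] by blast
    thus "\<exists>C\<in>insert {} padic_cubes. open C \<and> x \<in> C \<and> C \<subseteq> S \<inter> max_ideal_box"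
      using x padic_cube_subset_box[of x n] padic_cube_refl[of x n] open_padic_cube[of x n]
      unfolding padic_cubes_def by blast
  qed
qed

text \<open>\<open>{}\<close> is adjoined because two cubes that are not nested are
  disjoint.\<close>

lemma Int_stable_padic_cubes:
  "Int_stable (insert {} (padic_cubes :: ('m::finite \<Rightarrow> 'p::prime_card padic) set set))"
proof (rule Int_stableI)
  fix C D :: "('m \<Rightarrow> 'p padic) set"
  assume CD: "C \<in> insert {} padic_cubes" "D \<in> insert {} padic_cubes"
  show "C \<inter> D \<in> insert {} padic_cubes"
  proof (cases "C \<inter> D = {}")
    case False
    then obtain a n b l where "C = padic_cube a n" "D = padic_cube b l"
      using CD unfolding padic_cubes_def by blast
    hence "C \<inter> D \<in> {C, D}" using padic_cubes_nested[of a n b l] False by simp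
    thus ?thesis using CD by (elim insertE) simp_all
  qed simp
qed

lemma max_ideal_box_in_padic_cubes: "max_ideal_box \<in> padic_cubes"
  unfolding padic_cubes_def
  by (rule CollectI, rule exI[of _ "\<lambda>_. 0"], rule exI[of _ 1])
    (simp add: max_ideal_box_eq_cube)

section \<open>Haar measure of cubes, and measures giving equal mass to cubes of equal size\<close>

context
  fixes \<mu> :: "'p::prime_card padic measure"
  assumes haar: "normalized_haar \<mu>"
begin

lemma emeasure_haar_ball:
  assumes "a \<in> padic_max_ideal" "n \<ge> 1"
  shows "emeasure \<mu> {x. padic_abs (x - a) \<le> 1 / real CARD('p) ^ n} = ennreal (real CARD('p) powi (- (int n - 1)))"
proof -
  obtain b where b: "a = of_nat CARD('p) * b" "b \<in> padic_integers"
    using assms(1) by (auto simp: padic_max_ideal_def)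
  have "{x. padic_abs (x - a) \<le> 1 / real CARD('p) ^ n} = (\<lambda>z. of_nat CARD('p) * b + of_nat CARD('p) ^ n * z) ` padic_integers"
    using mem_padic_ball_iff[of _ a n] b by auto
  thus ?thesis using haar b(2) assms(2) by (simp add: normalized_haar_def)
qed

lemma sets_haar: "sets \<mu> = sets borel" and space_haar: "space \<mu> = UNIV"
  using haar sets_eq_imp_space_eq[of \<mu> borel] by (auto simp: normalized_haar_def)

lemma padic_max_ideal_borel: "padic_max_ideal \<in> sets \<mu>"
  using open_padic_cball[of "0 :: 'p padic" 1] by (simp add: sets_haar padic_max_ideal_eq)

lemma prob_space_restrict_haar: "prob_space (restrict_space \<mu> padic_max_ideal)"
proof
  have "(0 :: 'p padic) \<in> padic_max_ideal" by (simp add: padic_max_ideal_eq)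
  from emeasure_haar_ball[OF this, of 1]
  show "emeasure (restrict_space \<mu> padic_max_ideal) (space (restrict_space \<mu> padic_max_ideal)) = 1"
    using padic_max_ideal_borel by (simp add: emeasure_restrict_space space_restrict_space space_haar padic_max_ideal_eq)
qed

lemma prob_space_haar_power: "prob_space (haar_power \<mu>)"
  unfolding haar_power_def by (intro prob_space_PiM prob_space_restrict_haar)

lemma space_haar_power: "space (haar_power \<mu>) = max_ideal_box"
  by (auto simp: haar_power_def space_PiM space_restrict_space space_haar max_ideal_box_def PiE_iff)

text \<open>One inclusion is the continuity of the coordinate projections. The other rests on second
  countability, through which measurability of all coordinates gives measurability into the Borel
  space of the product.\<close>

lemma sets_haar_power: "sets (haar_power \<mu>) = sets (restrict_space borel (max_ideal_box :: ('m::finite \<Rightarrow> 'p padic) set))"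
proof
  show "sets (haar_power \<mu>) \<subseteq> sets (restrict_space borel (max_ideal_box :: ('m \<Rightarrow> 'p padic) set))"
    unfolding haar_power_def
  proof (rule sets_PiM_in_sets)
    show "space (restrict_space borel max_ideal_box) = (\<Pi>\<^sub>E k\<in>UNIV::'m set. space (restrict_space \<mu> padic_max_ideal))"
      using space_haar_power[where 'a = 'm] by (simp add: haar_power_def space_PiM space_restrict_space)
    fix i :: 'm and A assume "A \<in> sets (restrict_space \<mu> padic_max_ideal)"
    then obtain B where B: "B \<in> sets borel" "A = padic_max_ideal \<inter> B"
      by (auto simp: sets_restrict_space sets_haar)
    have "(\<lambda>x :: 'm \<Rightarrow> 'p padic. x i) -` B \<in> sets borel"
      using measurable_sets[OF borel_measurable_continuous_onI B(1), of "\<lambda>x. x i"] by simp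
    moreover have "{x \<in> space (restrict_space borel max_ideal_box). x i \<in> A} = max_ideal_box \<inter> (\<lambda>x :: 'm \<Rightarrow> 'p padic. x i) -` B"
      using B(2) by (auto simp: space_restrict_space max_ideal_box_def)
    ultimately show "{x \<in> space (restrict_space borel max_ideal_box). x i \<in> A} \<in> sets (restrict_space borel (max_ideal_box :: ('m \<Rightarrow> 'p padic) set))"
      unfolding sets_restrict_space by blast
  qed
  have "(\<lambda>x. x i) \<in> borel_measurable (haar_power \<mu> :: ('m \<Rightarrow> 'p padic) measure)" for i
  proof -
    have "(\<lambda>x. x i) \<in> measurable (haar_power \<mu> :: ('m \<Rightarrow> 'p padic) measure) (restrict_space \<mu> padic_max_ideal)"
      unfolding haar_power_def by (rule measurable_component_singleton) simp
    moreover have "(\<lambda>x. x) \<in> borel_measurable (restrict_space \<mu> padic_max_ideal)"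
      using sets_haar by (intro measurable_restrict_space1) (simp add: measurable_ident_sets)
    ultimately show ?thesis by (rule measurable_compose)
  qed
  hence "(\<lambda>x. x) \<in> borel_measurable (haar_power \<mu> :: ('m \<Rightarrow> 'p padic) measure)"
    by (rule measurable_coordinatewise_then_product)
  from measurable_sets[OF this]
  show "sets (restrict_space borel (max_ideal_box :: ('m \<Rightarrow> 'p padic) set)) \<subseteq> sets (haar_power \<mu>)"
    by (auto simp: sets_restrict_space space_haar_power Int_commute)
qed

lemma haar_power_borel: "A \<in> sets borel \<Longrightarrow> A \<subseteq> max_ideal_box \<Longrightarrow> A \<in> sets (haar_power \<mu>)"
  by (auto simp: sets_haar_power sets_restrict_space)

lemma haar_power_cube_measurable: "a \<in> max_ideal_box \<Longrightarrow> n \<ge> 1 \<Longrightarrow> padic_cube a n \<in> sets (haar_power \<mu>)"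
  by (simp add: haar_power_borel open_padic_cube padic_cube_subset_box)

lemma emeasure_haar_power_cube:
  fixes a :: "'m::finite \<Rightarrow> 'p padic"
  assumes "a \<in> max_ideal_box" "n \<ge> 1"
  shows "emeasure (haar_power \<mu>) (padic_cube a n) = ennreal (real CARD('p) powi (- (int n - 1))) ^ CARD('m)"
    (is "?lhs = _")
proof -
  let ?B = "\<lambda>k. {x. padic_abs (x - a k) \<le> 1 / real CARD('p) ^ n}"
  interpret product_prob_space "\<lambda>_. restrict_space \<mu> padic_max_ideal" UNIV
    by (simp add: product_prob_spaceI prob_space_restrict_haar)
  have a: "a k \<in> padic_max_ideal" for k using assms(1) by (simp add: max_ideal_box_def)
  \<comment> \<open>A ball is a cube over the one-element index type \<open>unit\<close>.\<close>
  have sub: "?B k \<subseteq> padic_max_ideal" for k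
    using padic_cube_subset_box[of "\<lambda>_::unit. a k" n] assms(2) a[of k]
    by (auto simp: padic_cube_def max_ideal_box_def)
  have meas: "?B k \<in> sets \<mu>" for k using open_padic_cball[of "a k"] by (simp add: sets_haar)
  have cube: "padic_cube a n = Pi\<^sub>E UNIV ?B" by (auto simp: padic_cube_def)
  have "?B k \<in> sets (restrict_space \<mu> padic_max_ideal)" for k
    using sub[of k] meas[of k] padic_max_ideal_borel
    by (subst sets_restrict_space_iff) (simp_all add: space_haar)
  hence "?lhs = (\<Prod>k\<in>UNIV. emeasure (restrict_space \<mu> padic_max_ideal) (?B k))"
    unfolding haar_power_def cube by (intro emeasure_PiM) simp_all
  also have "\<dots> = (\<Prod>k\<in>(UNIV::'m set). ennreal (real CARD('p) powi (- (int n - 1))))"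
  proof (rule prod.cong)
    fix k
    have "emeasure (restrict_space \<mu> padic_max_ideal) (?B k) = emeasure \<mu> (?B k)"
      using sub[of k] padic_max_ideal_borel by (intro emeasure_restrict_space) (simp_all add: space_haar)
    thus "emeasure (restrict_space \<mu> padic_max_ideal) (?B k) = ennreal (real CARD('p) powi (- (int n - 1)))"
      using emeasure_haar_ball[OF a[of k] assms(2)] by simp
  qed simp
  finally show ?thesis by simp
qed

text \<open>The cubes of level \<open>n\<close> form a countable partition of the box, so if they have equal measure,
  then it is determined by the total mass.\<close>

lemma emeasure_eq_scaled_haar_power:
  fixes N :: "('m::finite \<Rightarrow> 'p padic) measure"
  assumes sets: "sets N = sets (haar_power \<mu>)"
    and fin: "emeasure N max_ideal_box \<noteq> \<infinity>"
    and eq: "\<And>a b n. a \<in> max_ideal_box \<Longrightarrow> b \<in> max_ideal_box \<Longrightarrow> n \<ge> 1 \<Longrightarrow>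
      emeasure N (padic_cube a n) = emeasure N (padic_cube b n)"
  shows "N = scale_measure (emeasure N max_ideal_box) (haar_power \<mu>)"
proof (rule measure_eqI_generator_eq[where \<Omega> = max_ideal_box and A = "\<lambda>_. max_ideal_box"])
  show "Int_stable (insert {} (padic_cubes :: ('m \<Rightarrow> 'p padic) set set))" by (rule Int_stable_padic_cubes)
  show "insert {} padic_cubes \<subseteq> Pow (max_ideal_box :: ('m \<Rightarrow> 'p padic) set)"
    using padic_cube_subset_box by (auto simp: padic_cubes_def)
  show "sets N = sigma_sets max_ideal_box (insert {} padic_cubes)"
    by (simp add: sets sets_haar_power sets_restrict_max_ideal_box)
  show "sets (scale_measure (emeasure N max_ideal_box) (haar_power \<mu>)) = sigma_sets max_ideal_box (insert {} padic_cubes)"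
    by (simp add: sets_haar_power sets_restrict_max_ideal_box)
  show "range (\<lambda>_::nat. max_ideal_box) \<subseteq> insert {} (padic_cubes :: ('m \<Rightarrow> 'p padic) set set)"
    using max_ideal_box_in_padic_cubes by auto
  fix X :: "('m \<Rightarrow> 'p padic) set" assume "X \<in> insert {} padic_cubes"
  then consider "X = {}" | a n where "X = padic_cube a n" "a \<in> max_ideal_box" "n \<ge> 1"
    by (auto simp: padic_cubes_def)
  thus "emeasure N X = emeasure (scale_measure (emeasure N max_ideal_box) (haar_power \<mu>)) X"
  proof cases
    case (2 a n)
    define \<C> where "\<C> = (\<lambda>b. padic_cube b n) ` (max_ideal_box :: ('m \<Rightarrow> 'p padic) set)"
    have "\<And>S. S \<in> \<C> \<Longrightarrow> open S" by (auto simp: \<C>_def open_padic_cube)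
    then obtain \<F> where \<F>: "\<F> \<subseteq> \<C>" "countable \<F>" "\<Union>\<F> = \<Union>\<C>" using Lindelof by blast
    have cover: "\<Union>\<F> = max_ideal_box"
      unfolding \<F>(3) \<C>_def using padic_cube_subset_box[OF _ 2(3)] padic_cube_refl by blast
    have disj: "disjoint_family_on (\<lambda>C. C) \<F>"
    proof (unfold disjoint_family_on_def, intro ballI impI)
      fix C D assume CD: "C \<in> \<F>" "D \<in> \<F>" "C \<noteq> D"
      then obtain b c where "C = padic_cube b n" "D = padic_cube c n"
        using \<F>(1) unfolding \<C>_def by (meson image_iff subsetD)
      thus "C \<inter> D = {}" using padic_cube_eq[of _ b n] padic_cube_eq[of _ c n] CD(3) by blast
    qed
    \<comment> \<open>The number of cubes stays an \<open>ennreal\<close> and is never computed: for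
      \<open>haar_power \<mu>\<close> the equation identifies it as the reciprocal of the mass of
      one cube, and this is then inserted into the equation for \<open>N\<close>.\<close>
    have total: "emeasure M max_ideal_box = emeasure M (padic_cube a n) * emeasure (count_space \<F>) \<F>"
      if M: "sets M = sets (haar_power \<mu>)"
        "\<And>b. b \<in> max_ideal_box \<Longrightarrow> emeasure M (padic_cube b n) = emeasure M (padic_cube a n)" for M
    proof -
      have "emeasure M (\<Union>C\<in>\<F>. C) = (\<integral>\<^sup>+C. emeasure M C \<partial>count_space \<F>)"
        using \<F>(1,2) disj 2(3)
        by (intro emeasure_UN_countable) (auto simp: \<C>_def M(1) haar_power_cube_measurable)
      also have "\<dots> = (\<integral>\<^sup>+C. emeasure M (padic_cube a n) \<partial>count_space \<F>)"
        using \<F>(1) M(2) by (intro nn_integral_cong) (auto simp: \<C>_def)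
      finally show ?thesis by (simp add: cover)
    qed
    have "1 = emeasure (haar_power \<mu>) (padic_cube a n) * emeasure (count_space \<F>) \<F>"
      using total[of "haar_power \<mu>"] 2 prob_space.emeasure_space_1[OF prob_space_haar_power[where 'a = 'm]]
      by (simp add: emeasure_haar_power_cube space_haar_power)
    moreover have "emeasure N max_ideal_box = emeasure N (padic_cube a n) * emeasure (count_space \<F>) \<F>"
      using total[of N] eq 2 sets by blast
    ultimately have "emeasure N (padic_cube a n) = emeasure N max_ideal_box * emeasure (haar_power \<mu>) (padic_cube a n)"
      by (metis (no_types, lifting) mult.assoc mult.commute mult_1)
    thus ?thesis using 2(1) by simp
  qed simp
qed (use fin in auto)

lemma measurable_haar_powerI:
  assumes "f \<in> borel_measurable borel" "\<And>x. x \<in> max_ideal_box \<Longrightarrow> f x \<in> max_ideal_box"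
  shows "f \<in> measurable (haar_power \<mu>) (haar_power \<mu>)"
  using measurable_restrict_space3[OF assms(1), of max_ideal_box max_ideal_box] assms(2)
  by (simp add: measurable_cong_sets[OF sets_haar_power sets_haar_power] Pi_iff)

text \<open>Translation by v permutes the cubes of each level, and these have equal mass. So the
  image measure is a multiple of \<open>haar_power \<mu>\<close>, and its total mass is 1.\<close>

lemma haar_power_translate:
  fixes v :: "'m::finite \<Rightarrow> 'p padic"
  assumes v: "v \<in> max_ideal_box" and A: "A \<in> sets (haar_power \<mu>)"
  shows "(\<lambda>x k. x k + v k) -` A \<inter> max_ideal_box \<in> sets (haar_power \<mu>)"
    and "emeasure (haar_power \<mu>) ((\<lambda>x k. x k + v k) -` A \<inter> max_ideal_box) = emeasure (haar_power \<mu>) A"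
proof -
  let ?t = "\<lambda>x k. x k + v k"
  define N where "N = distr (haar_power \<mu>) (haar_power \<mu>) ?t"
  have t: "?t \<in> measurable (haar_power \<mu>) (haar_power \<mu>)"
    using v max_ideal_box_add
    by (intro measurable_haar_powerI borel_measurable_continuous_onI continuous_intros continuous_on_product_coordinates) auto
  show "?t -` A \<inter> max_ideal_box \<in> sets (haar_power \<mu>)"
    using measurable_sets[OF t A] by (simp add: space_haar_power)
  have "prob_space N" unfolding N_def by (rule prob_space.prob_space_distr[OF prob_space_haar_power t])
  hence N1: "emeasure N max_ideal_box = 1"
    using prob_space.emeasure_space_1[of N] by (simp add: N_def space_haar_power)
  have cube: "emeasure N (padic_cube a n) = ennreal (real CARD('p) powi (- (int n - 1))) ^ CARD('m)"
    if "a \<in> max_ideal_box" "n \<ge> 1" for a n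
  proof -
    have "?t -` padic_cube a n \<inter> max_ideal_box = padic_cube (\<lambda>k. a k - v k) n"
      using padic_cube_subset_box[OF max_ideal_box_diff[OF that(1) v] that(2)]
      by (auto simp: padic_cube_def algebra_simps)
    thus ?thesis using that v
      by (simp add: N_def emeasure_distr[OF t] haar_power_cube_measurable space_haar_power
          emeasure_haar_power_cube max_ideal_box_diff)
  qed
  have "N = scale_measure (emeasure N max_ideal_box) (haar_power \<mu>)"
    by (rule emeasure_eq_scaled_haar_power) (simp_all add: N1 cube, simp add: N_def)
  hence "N = haar_power \<mu>" by (simp add: N1)
  thus "emeasure (haar_power \<mu>) (?t -` A \<inter> max_ideal_box) = emeasure (haar_power \<mu>) A"
    using emeasure_distr[OF t A] by (simp add: N_def space_haar_power)
qed

end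

section \<open>Rational hyperplanes\<close>

definition rational_hyperplane :: "int \<Rightarrow> ('m::finite \<Rightarrow> int) \<Rightarrow> ('m \<Rightarrow> 'p::prime_card padic) set" where
  "rational_hyperplane c\<^sub>0 c = {x. of_int c\<^sub>0 + (\<Sum>k\<in>UNIV. of_int (c k) * x k) = 0}"

lemma indep_vectors_eq: "D\<^sub>m = UNIV - (\<Union>(c\<^sub>0, c)\<in>{(c\<^sub>0, c). c\<^sub>0 \<noteq> 0 \<or> (\<exists>k. c k \<noteq> 0)}. rational_hyperplane c\<^sub>0 c)"
  by (auto simp: indep_vectors_def rational_hyperplane_def)

lemma rational_hyperplane_borel:
  "rational_hyperplane c\<^sub>0 c \<in> sets (borel :: ('m::finite \<Rightarrow> 'p::prime_card padic) measure)"
proof -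
  have "continuous_on UNIV (\<lambda>x :: 'm \<Rightarrow> 'p padic. of_int c\<^sub>0 + (\<Sum>k\<in>UNIV. of_int (c k) * x k))"
    by (intro continuous_intros continuous_on_product_coordinates)
  from closed_Collect_eq[OF this continuous_on_const[of _ 0]]
  show ?thesis by (simp add: rational_hyperplane_def)
qed

lemma indep_vectors_borel: "D\<^sub>m \<in> sets (borel :: ('m::finite \<Rightarrow> 'p::prime_card padic) measure)"
  unfolding indep_vectors_eq
  by (intro sets.Diff sets.countable_UN'') (auto intro: rational_hyperplane_borel countable_subset[OF subset_UNIV])

lemma indep_vectors_max_ideal_eq: "D\<^sub>m' = D\<^sub>m \<inter> max_ideal_box"
  by (simp add: indep_vectors_max_ideal_def max_ideal_box_def)

lemma indep_vectors_max_ideal_borel: "D\<^sub>m' \<in> sets (borel :: ('m::finite \<Rightarrow> 'p::prime_card padic) measure)"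
  unfolding indep_vectors_max_ideal_eq
  by (intro sets.Int indep_vectors_borel borel_open open_max_ideal_box)

context
  fixes \<mu> :: "'p::prime_card padic measure"
  assumes haar: "normalized_haar \<mu>"
begin

text \<open>The translates of the hyperplane by \<open>p\<^sup>j e\<^sub>k\<close>, \<open>j \<ge> 1\<close>, are disjoint and of equal measure.\<close>

lemma rational_hyperplane_null:
  fixes c :: "'m::finite \<Rightarrow> int"
  assumes "c\<^sub>0 \<noteq> 0 \<or> c k \<noteq> 0"
  shows "rational_hyperplane c\<^sub>0 c \<inter> max_ideal_box \<in> null_sets (haar_power \<mu>)"
proof (cases "\<exists>k. c k \<noteq> 0")
  case True
  then obtain k where k: "c k \<noteq> 0" by blast
  interpret prob_space "haar_power \<mu> :: ('m \<Rightarrow> 'p padic) measure" by (rule prob_space_haar_power[OF haar])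
  define S :: "('m \<Rightarrow> 'p padic) set" where "S = rational_hyperplane c\<^sub>0 c \<inter> max_ideal_box"
  \<comment> \<open>The exponent \<open>Suc j\<close> keeps the translation vectors in the
    box.\<close>
  define e :: "nat \<Rightarrow> 'm \<Rightarrow> 'p padic" where "e = (\<lambda>j l. if l = k then of_nat CARD('p) ^ Suc j else 0)"
  define S' where "S' j = (\<lambda>x l. x l + e j l) -` S \<inter> max_ideal_box" for j
  have p: "real CARD('p) > 1" by (rule p_gt_1[OF prime_card])
  have e: "e j \<in> max_ideal_box" for j
  proof -
    have "(1 / real CARD('p)) ^ Suc j \<le> (1 / real CARD('p)) ^ 1"
      using p by (intro power_decreasing) auto
    thus ?thesis
      by (simp add: max_ideal_box_def e_def padic_max_ideal_eq padic_abs_power padic_abs_of_nat_card del: power_Suc)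
  qed
  have S: "S \<in> events"
    unfolding S_def
    by (intro haar_power_borel[OF haar] sets.Int rational_hyperplane_borel borel_open open_max_ideal_box Int_lower2)
  have S': "S' j \<in> events" "prob (S' j) = prob S" for j
    using haar_power_translate[OF haar e S] by (simp_all add: S'_def measure_def)
  have "disjoint_family S'"
  proof (unfold disjoint_family_on_def, intro ballI impI)
    fix i j :: nat assume "i \<noteq> j"
    \<comment> \<open>On \<open>S' j\<close> the affine form that defines the hyperplane takes the
      value -c_k p^(j+1). The values for different j are distinct, as c_k is nonzero and the
      characteristic is 0.\<close>
    have lin: "(\<Sum>l\<in>UNIV. of_int (c l) * (x l + e j l)) = (\<Sum>l\<in>UNIV. of_int (c l) * x l) + of_int (c k) * of_nat CARD('p) ^ Suc j"
      for x :: "'m \<Rightarrow> 'p padic" and j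
    proof -
      have "(\<Sum>l\<in>UNIV. of_int (c l) * e j l) = of_int (c k) * of_nat CARD('p) ^ Suc j"
        by (simp add: e_def if_distrib[of "\<lambda>z. _ * z"] cong: if_cong)
      thus ?thesis by (simp add: distrib_left sum.distrib)
    qed
    have "(of_nat (CARD('p) ^ Suc i) :: 'p padic) \<noteq> of_nat (CARD('p) ^ Suc j)"
      using p \<open>i \<noteq> j\<close> by (subst of_nat_eq_iff) (simp del: power_Suc)
    hence "of_int (c k) * of_nat CARD('p) ^ Suc i \<noteq> (of_int (c k) * of_nat CARD('p) ^ Suc j :: 'p padic)"
      using k by (simp del: power_Suc)
    moreover have "of_int c\<^sub>0 + ((\<Sum>l\<in>UNIV. of_int (c l) * x l) + of_int (c k) * of_nat CARD('p) ^ Suc j) = 0"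
      if "x \<in> S' j" for x j
      using that unfolding S'_def S_def rational_hyperplane_def by (simp only: lin vimage_eq Int_iff mem_Collect_eq)
    ultimately show "S' i \<inter> S' j = {}" by (metis (no_types, lifting) add_left_cancel disjoint_iff)
  qed
  hence "(\<lambda>j. prob (S' j)) sums prob (\<Union>j. S' j)" using S'(1) by (intro finite_measure_UNION) auto
  \<comment> \<open>Infinitely many disjoint sets share one probability; a constant series converges
    only if its terms are 0.\<close>
  hence "summable (\<lambda>j::nat. prob S)" by (simp add: S'(2) sums_iff)
  hence "prob S = 0" using summable_const_iff[of "prob S"] by blast
  thus ?thesis using S by (simp add: S_def null_sets_def emeasure_eq_measure)
next
  case False
  hence "rational_hyperplane c\<^sub>0 c = ({} :: ('m \<Rightarrow> 'p padic) set)" using assms by (auto simp: rational_hyperplane_def)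
  thus ?thesis by simp
qed

lemma indep_vectors_complement_null:
  "max_ideal_box - D\<^sub>m \<in> null_sets (haar_power \<mu> :: ('m::finite \<Rightarrow> 'p padic) measure)"
proof -
  have "(\<Union>(c\<^sub>0, c)\<in>{(c\<^sub>0, c). c\<^sub>0 \<noteq> 0 \<or> (\<exists>k. c k \<noteq> 0)}. rational_hyperplane c\<^sub>0 c \<inter> max_ideal_box)
      \<in> null_sets (haar_power \<mu> :: ('m \<Rightarrow> 'p padic) measure)"
    using rational_hyperplane_null by (intro null_sets_UN') (auto intro: countable_subset[OF subset_UNIV])
  also have "(\<Union>(c\<^sub>0, c)\<in>{(c\<^sub>0, c). c\<^sub>0 \<noteq> 0 \<or> (\<exists>k. c k \<noteq> 0)}. rational_hyperplane c\<^sub>0 c \<inter> max_ideal_box)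
      = max_ideal_box - (D\<^sub>m :: ('m \<Rightarrow> 'p padic) set)"
    by (auto simp: indep_vectors_eq)
  finally show ?thesis .
qed

end

section \<open>Hyperbolic maps\<close>

text \<open>Hyperbolicity in terms of absolute values, with p-adic parameters: \<open>u\<close> and
  \<open>w\<close> will be the images of \<open>P\<close> and \<open>Q\<close>. \<open>R\<close>
  turns out to be the absolute value of the coordinate x_i on the whole branch. The factor 1/p in
  the bounds is what discreteness of the absolute value extracts from strict inequalities; the last
  two bounds together stand for one with max 1 |w_k|.\<close>

locale hyperbolic_map =
  fixes i :: "'m::finite" and \<sigma> :: "'m \<Rightarrow> 'm" and u w :: "'m \<Rightarrow> 'p::prime_card padic" and s :: 'm and R :: real
  defines "s \<equiv> inv \<sigma> i" and "R \<equiv> padic_abs (u s) / padic_abs (w s)"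
  assumes bij: "bij \<sigma>"
    and u_nonzero: "\<And>k. u k \<noteq> 0"
    and w_s: "padic_abs (w s) \<ge> 1"
    and R_le: "R \<le> 1 / real CARD('p)"
    and R_le_u: "\<And>k. k \<noteq> s \<Longrightarrow> R \<le> padic_abs (u k) / real CARD('p)"
    and Rw_le_u: "\<And>k. k \<noteq> s \<Longrightarrow> R * padic_abs (w k) \<le> padic_abs (u k) / real CARD('p)"
begin

definition f :: "('m \<Rightarrow> 'p padic) \<Rightarrow> 'm \<Rightarrow> 'p padic" where
  "f x = (\<lambda>k. if k = s then u k / x i - w k else u k * x (\<sigma> k) / x i - w k)"

text \<open>A cell enlarged by linearly dependent points. Its image is the full box, so cubes can be
  pulled back.\<close>

definition V :: "('m \<Rightarrow> 'p padic) set" where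
  "V = {x \<in> max_ideal_box. x i \<noteq> 0 \<and> f x \<in> max_ideal_box}"

lemma card_p_gt_1: "real CARD('p) > 1"
  by (rule p_gt_1[OF prime_card])

lemma sigma_s: "\<sigma> s = i"
  using bij by (simp add: s_def bij_is_surj surj_f_inv_f)

lemma R_pos: "R > 0"
  unfolding R_def using u_nonzero w_s by (intro divide_pos_pos) (auto simp del: padic_abs_pos_iff simp: less_le)

lemma sigma_cases:
  obtains "j = i" | k where "k \<noteq> s" "j = \<sigma> k"
  using bij sigma_s by (metis bij_pointE)

lemma box_abs_le: "y \<in> max_ideal_box \<Longrightarrow> padic_abs (y k :: 'p padic) \<le> 1 / real CARD('p)"
  by (simp add: max_ideal_box_def padic_max_ideal_eq)

lemma box_abs_le_1: "y \<in> max_ideal_box \<Longrightarrow> padic_abs (y k :: 'p padic) \<le> 1"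
  using box_abs_le[of y k] card_p_gt_1 by (simp add: order.trans)

lemma abs_add_w_s:
  assumes "y \<in> max_ideal_box"
  shows "padic_abs (y s + w s) = padic_abs (w s)"
proof -
  have "1 / real CARD('p) < 1" using card_p_gt_1 by simp
  hence "padic_abs (y s) < padic_abs (w s)" using box_abs_le[OF assms, of s] w_s by linarith
  thus ?thesis using padic_abs_add_eq[of "y s" "w s"] by (simp add: add.commute)
qed

text \<open>The bounds for 1 and for |w_k| suffice, since |y_k + w_k| is at most the larger of the
  two.\<close>

lemma R_abs_add_w_le:
  assumes "y \<in> max_ideal_box" "k \<noteq> s"
  shows "R * padic_abs (y k + w k) \<le> padic_abs (u k) / real CARD('p)"
proof (cases "padic_abs (w k) \<le> 1")
  case True
  hence "padic_abs (y k + w k) \<le> 1" using box_abs_le_1[OF assms(1)] by (intro padic_abs_add_le)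
  hence "R * padic_abs (y k + w k) \<le> R * 1" using R_pos by (intro mult_left_mono) auto
  thus ?thesis using R_le_u[OF assms(2)] by simp
next
  case False
  hence "padic_abs (y k + w k) \<le> padic_abs (w k)"
    using box_abs_le_1[OF assms(1), of k] by (intro padic_abs_add_le) auto
  hence "R * padic_abs (y k + w k) \<le> R * padic_abs (w k)" using R_pos by (intro mult_left_mono) auto
  thus ?thesis using Rw_le_u[OF assms(2)] by simp
qed

text \<open>The third fact is the key: u_s / x_i = f x s + w s has the absolute value of w_s,
  because a coordinate of a point of the box is smaller. So |x_i| is constant on
  \<open>V\<close>.\<close>

lemma V_i:
  assumes "x \<in> V"
  shows "x i \<noteq> 0" "f x s + w s = u s / x i" "padic_abs (x i) = R"
proof -
  show nz: "x i \<noteq> 0" using assms by (simp add: V_def)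
  show *: "f x s + w s = u s / x i" by (simp add: f_def)
  have "padic_abs (w s) = padic_abs (u s) / padic_abs (x i)"
    using abs_add_w_s[of "f x"] assms by (simp add: * padic_abs_divide V_def)
  moreover have "w s \<noteq> 0" using w_s by auto
  ultimately show "padic_abs (x i) = R" using nz by (simp add: R_def field_simps)
qed

lemma V_sigma:
  assumes "x \<in> V" "k \<noteq> s"
  shows "x (\<sigma> k) = x i * (f x k + w k) / u k"
  using assms V_i(1)[OF assms(1)] u_nonzero[of k] by (simp add: f_def)

text \<open>On the sphere |x_i| = R inversion scales all distances by 1/R^2; with |u_s| = R |w_s|
  the passage from x_i to f x s scales them by |w_s| / R.\<close>

lemma abs_diff_i:
  assumes "x \<in> V" "y \<in> V"
  shows "padic_abs (x i - y i) = R * padic_abs (f x s - f y s) / padic_abs (w s)"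
proof -
  note x = V_i[OF assms(1)] and y = V_i[OF assms(2)]
  have "f x s - f y s = (f x s + w s) - (f y s + w s)" by simp
  also have "\<dots> = - u s * (x i - y i) / (x i * y i)"
    unfolding x(2) y(2) using x(1) y(1) by (simp add: field_simps)
  finally have "padic_abs (f x s - f y s) = padic_abs (u s) * padic_abs (x i - y i) / (R * R)"
    by (simp add: padic_abs_divide padic_abs_mult padic_abs_minus x(3) y(3))
  moreover have "padic_abs (u s) = R * padic_abs (w s)" using w_s by (auto simp: R_def)
  ultimately show ?thesis using R_pos w_s by (auto simp: field_simps)
qed

lemma abs_diff_i_le:
  assumes "x \<in> V" "y \<in> V" "padic_abs (f x s - f y s) \<le> r"
  shows "padic_abs (x i - y i) \<le> R * r"
proof -
  have "R * padic_abs (f x s - f y s) / padic_abs (w s) \<le> R * padic_abs (f x s - f y s) / 1"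
    using w_s R_pos by (intro divide_left_mono) auto
  also have "\<dots> \<le> R * r" using R_pos assms(3) by simp
  finally show ?thesis using abs_diff_i[OF assms(1,2)] by simp
qed

text \<open>x_i varies by at most R r, which settles j = i. Any other coordinate is x_i (f x k + w
  k) / u_k, and varying the two factors in turn leads to the bounds of R and of R |f y k + w k| by
  |u_k| / p.\<close>

lemma contraction:
  assumes "x \<in> V" "y \<in> V" "\<And>k. padic_abs (f x k - f y k) \<le> r"
  shows "padic_abs (x j - y j) \<le> r / real CARD('p)"
proof (cases j rule: sigma_cases)
  case 1
  have "r \<ge> 0" using padic_abs_nonneg assms(3) order.trans by blast
  hence "R * r \<le> r / real CARD('p)" using mult_right_mono[OF R_le, of r] by simp
  thus ?thesis using abs_diff_i_le[OF assms(1,2,3)] 1 by simp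
next
  case (2 k)
  have r: "r \<ge> 0" using padic_abs_nonneg assms(3) order.trans by blast
  \<comment> \<open>Difference of two products, changing one factor at a time.\<close>
  have "x j - y j = (x i * (f x k - f y k) + (x i - y i) * (f y k + w k)) / u k"
    unfolding 2(2) V_sigma[OF assms(1) 2(1)] V_sigma[OF assms(2) 2(1)]
    using u_nonzero[of k] by (simp add: field_simps)
  also have "padic_abs \<dots> \<le> r / real CARD('p)"
  proof -
    have "R * padic_abs (f x k - f y k) \<le> padic_abs (u k) / real CARD('p) * r"
      using R_le_u[OF 2(1)] assms(3) R_pos by (intro mult_mono) auto
    moreover have "padic_abs (x i - y i) * padic_abs (f y k + w k) \<le> padic_abs (u k) / real CARD('p) * r"
    proof -
      have "padic_abs (x i - y i) * padic_abs (f y k + w k) \<le> (R * r) * padic_abs (f y k + w k)"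
        using abs_diff_i_le[OF assms(1,2,3)] by (intro mult_right_mono) auto
      also have "\<dots> = R * padic_abs (f y k + w k) * r" by simp
      also have "\<dots> \<le> padic_abs (u k) / real CARD('p) * r"
        using R_abs_add_w_le[of "f y" k] assms(2) 2(1) r by (intro mult_right_mono) (auto simp: V_def)
      finally show ?thesis .
    qed
    ultimately have "padic_abs (x i * (f x k - f y k) + (x i - y i) * (f y k + w k)) \<le> padic_abs (u k) / real CARD('p) * r"
      by (intro padic_abs_add_le) (simp_all add: padic_abs_mult V_i(3)[OF assms(1)])
    thus ?thesis using u_nonzero[of k] card_p_gt_1 by (simp add: padic_abs_divide field_simps)
  qed
  finally show ?thesis .
qed

text \<open>Coordinate s determines x_i, and then every other equation is linear in its own unknown
  x (\<sigma> k). The hyperbolic bounds keep the solution in the box.\<close>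

lemma surj_on_box:
  assumes b: "b \<in> max_ideal_box"
  obtains x where "x \<in> V" "f x = b"
proof
  define t where "t = u s / (b s + w s)"
  define x where "x = (\<lambda>j. if j = i then t else t * (b (inv \<sigma> j) + w (inv \<sigma> j)) / u (inv \<sigma> j))"
  have bw: "padic_abs (b s + w s) = padic_abs (w s)" by (rule abs_add_w_s[OF b])
  hence "b s + w s \<noteq> 0" using w_s by auto
  hence t: "t \<noteq> 0" "u s / t = b s + w s" using u_nonzero by (simp_all add: t_def)
  have abs_t: "padic_abs t = R" by (simp add: t_def padic_abs_divide bw R_def)
  have x_i: "x i = t" by (simp add: x_def)
  have x_sigma: "x (\<sigma> k) = t * (b k + w k) / u k" if "k \<noteq> s" for k
    using that bij sigma_s bij_is_inj[OF bij] by (auto simp: x_def inv_f_f inj_eq s_def)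
  show fx: "f x = b"
  proof
    show "f x k = b k" for k
      using t u_nonzero[of k] by (cases "k = s") (simp_all add: f_def x_i x_sigma)
  qed
  have "padic_abs (x j) \<le> 1 / real CARD('p)" for j
  proof (cases j rule: sigma_cases)
    case (2 k)
    have "padic_abs (x j) = R * padic_abs (b k + w k) / padic_abs (u k)"
      by (simp add: 2 x_sigma padic_abs_divide padic_abs_mult abs_t)
    also have "\<dots> \<le> padic_abs (u k) / real CARD('p) / padic_abs (u k)"
      using R_abs_add_w_le[OF b 2(1)] by (intro divide_right_mono) auto
    finally show ?thesis using u_nonzero[of k] by simp
  qed (simp add: x_i abs_t R_le)
  thus "x \<in> V"
    using b t by (simp add: V_def fx x_i) (simp add: max_ideal_box_def padic_max_ideal_eq)
qed

text \<open>The map \<open>f\<close> is so close to being affine that a translation moves the preimage of one cube onto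
  the preimage of another of the same size.\<close>

lemma translate:
  assumes V: "x \<in> V" "a \<in> V" "b \<in> V" and n: "n \<ge> 1" and x: "f x \<in> padic_cube (f a) n"
  defines "z \<equiv> \<lambda>k. x k + (b k - a k)"
  shows "z \<in> V" "f z \<in> padic_cube (f b) n"
proof -
  define r where "r = 1 / real CARD('p) ^ n"
  have "1 / real CARD('p) ^ n \<le> 1 / real CARD('p) ^ 1"
    using n card_p_gt_1 by (intro divide_left_mono power_increasing) auto
  also have "\<dots> < 1" using card_p_gt_1 by simp
  finally have r: "0 < r" "r < 1" using card_p_gt_1 by (simp_all add: r_def)
  have fr: "padic_abs (f x k - f a k) \<le> r" for k using x by (simp add: padic_cube_def r_def)
  note xi = V_i[OF V(1)] and ai = V_i[OF V(2)] and bi = V_i[OF V(3)]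
  \<comment> \<open>As |x_i - a_i| < R = |b_i|, the coordinate z_i = b_i + (x_i - a_i) stays on the
    sphere of radius R.\<close>
  have d: "padic_abs (x i - a i) \<le> R * r" by (rule abs_diff_i_le[OF V(1,2) fr])
  have "R * r < R" using R_pos r by simp
  hence zi: "padic_abs (z i) = R"
    using padic_abs_add_eq[of "x i - a i" "b i"] d bi(3) by (simp add: z_def algebra_simps)
  hence z0: "z i \<noteq> 0" using R_pos by auto
  have "padic_abs (f z k - f b k) \<le> r" for k
  proof (cases "k = s")
    case True
    have "f z k - f b k = - u s * (x i - a i) / (z i * b i)"
      using True z0 bi(1) by (simp add: f_def field_simps) (simp add: z_def algebra_simps)
    hence "padic_abs (f z k - f b k) = padic_abs (u s) * (R * padic_abs (f x s - f a s) / padic_abs (w s)) / (R * R)"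
      by (simp add: padic_abs_divide padic_abs_mult padic_abs_minus zi bi(3) abs_diff_i[OF V(1,2)])
    also have "\<dots> = padic_abs (f x s - f a s)"
      using w_s R_pos u_nonzero[of s] by (auto simp: R_def field_simps)
    finally show ?thesis using fr by simp
  next
    case False
    \<comment> \<open>The difference is expressed through f x k - f a k, of size at most r, and (x_i
      - a_i) (f a k - f b k), of size at most R r; \<open>w k\<close> cancels. With their
      coefficients both terms are at most r R^2, and the denominator z_i b_i has absolute value
      R^2.\<close>
    have id: "c * (xj + (bj - aj)) / zi - c * bj / bi =
        ((bi / ai) * (c * xj / xi - c * aj / ai) * xi * ai + (xi - ai) * bi * (c * aj / ai - c * bj / bi)) / (zi * bi)"
      if "xi \<noteq> 0" "ai \<noteq> 0" "bi \<noteq> 0" "zi \<noteq> 0" "zi = xi + (bi - ai)" for c xi ai bi xj aj bj zi :: "'p padic"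
    proof -
      have "(bi / ai) * (c * xj / xi - c * aj / ai) * xi * ai = bi * c * xj - bi * c * aj * xi / ai"
        using that(1-3) by (simp add: field_simps)
      moreover have "(xi - ai) * bi * (c * aj / ai - c * bj / bi) = bi * c * aj * xi / ai - bi * c * aj - (xi - ai) * c * bj"
        using that(1-3) by (simp add: field_simps)
      ultimately show ?thesis
        using that(3,4) by (simp add: diff_frac_eq) (simp add: that(5) algebra_simps)
    qed
    have "f z k - f b k = ((b i / a i) * (f x k - f a k) * x i * a i + (x i - a i) * b i * (f a k - f b k)) / (z i * b i)"
      using id[OF xi(1) ai(1) bi(1) z0, of "u k" "x (\<sigma> k)" "b (\<sigma> k)" "a (\<sigma> k)"] False
      by (simp add: f_def z_def)
    moreover have "padic_abs ((b i / a i) * (f x k - f a k) * x i * a i + (x i - a i) * b i * (f a k - f b k)) \<le> r * (R * R)"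
    proof (rule padic_abs_add_le)
      show "padic_abs ((b i / a i) * (f x k - f a k) * x i * a i) \<le> r * (R * R)"
        using fr[of k] R_pos by (simp add: padic_abs_mult padic_abs_divide xi ai bi)
      have "padic_abs (f a k - f b k) \<le> 1"
        using V(2,3) by (intro padic_abs_diff_le box_abs_le_1) (simp_all add: V_def)
      hence "padic_abs (x i - a i) * R * padic_abs (f a k - f b k) \<le> (R * r) * R * 1"
        using d R_pos r by (intro mult_mono) auto
      thus "padic_abs ((x i - a i) * b i * (f a k - f b k)) \<le> r * (R * R)"
        by (simp add: padic_abs_mult bi mult_ac)
    qed
    ultimately show ?thesis using R_pos by (simp add: padic_abs_divide padic_abs_mult zi bi divide_le_eq)
  qed
  thus fz: "f z \<in> padic_cube (f b) n" by (simp add: padic_cube_def r_def)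
  have "f z \<in> max_ideal_box" using fz padic_cube_subset_box[OF _ n] V(3) by (auto simp: V_def)
  moreover have "z \<in> max_ideal_box"
    using V unfolding z_def by (intro max_ideal_box_add max_ideal_box_diff) (simp_all add: V_def)
  ultimately show "z \<in> V" using z0 by (simp add: V_def)
qed

section \<open>Measurability and measure of preimages under a branch\<close>

lemma vimage_borel:
  assumes "A \<in> sets borel"
  shows "{x. x i \<noteq> 0 \<and> f x \<in> A} \<in> sets borel"
proof -
  \<comment> \<open>Continuity is available off the hyperplane x_i = 0, on which the total division
    returns 0.\<close>
  have op: "open {x :: 'm \<Rightarrow> 'p padic. x i \<noteq> 0}"
    by (intro open_Collect_neq continuous_on_product_coordinates continuous_on_const)
  have c: "continuous_on S (\<lambda>x :: 'm \<Rightarrow> 'p padic. x k)" for S k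
    by (rule continuous_on_subset[OF continuous_on_product_coordinates]) simp
  have "continuous_on {x. x i \<noteq> 0} (\<lambda>x. f x k)" for k
    by (cases "k = s") (auto simp: f_def divide_inverse intro!: continuous_intros continuous_on_padic_inverse c)
  hence "continuous_on {x. x i \<noteq> 0} f" by (rule continuous_on_coordinatewise_then_product)
  hence "f \<in> borel_measurable (restrict_space borel {x. x i \<noteq> 0})"
    by (rule borel_measurable_continuous_on_restrict)
  from measurable_sets[OF this assms]
  have "f -` A \<inter> {x. x i \<noteq> 0} \<in> sets borel"
    using op by (subst (asm) sets_restrict_space_iff) (simp_all add: space_restrict_space)
  thus ?thesis by (simp add: vimage_def Int_def conj_commute)
qed

lemma V_vimage_borel: "A \<in> sets borel \<Longrightarrow> V \<inter> f -` A \<in> sets borel"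
proof -
  assume "A \<in> sets borel"
  hence "max_ideal_box \<inter> {x. x i \<noteq> 0 \<and> f x \<in> max_ideal_box \<inter> A} \<in> sets borel"
    by (rule sets.Int[OF borel_open[OF open_max_ideal_box]
          vimage_borel[OF sets.Int[OF borel_open[OF open_max_ideal_box]]]])
  also have "max_ideal_box \<inter> {x. x i \<noteq> 0 \<and> f x \<in> max_ideal_box \<inter> A} = V \<inter> f -` A"
    by (auto simp: V_def)
  finally show ?thesis .
qed

lemma emeasure_vimage:
  fixes \<mu> :: "'p padic measure"
  assumes haar: "normalized_haar \<mu>" and A: "A \<in> sets borel" "A \<subseteq> max_ideal_box"
  shows "emeasure (haar_power \<mu>) (V \<inter> f -` A) = emeasure (haar_power \<mu>) V * emeasure (haar_power \<mu>) A"
proof -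
  let ?H = "haar_power \<mu> :: ('m \<Rightarrow> 'p padic) measure"
  have VH: "V \<inter> f -` B \<in> sets ?H" if "B \<in> sets borel" for B
    using V_vimage_borel[OF that] by (intro haar_power_borel[OF haar]) (auto simp: V_def)
  have V: "V \<in> sets ?H" using VH[of UNIV] by simp
  \<comment> \<open>The mass of \<open>V\<close> pushed forward to the box; its total, the measure
    of \<open>V\<close>, becomes the factor in the claim.\<close>
  define N where "N = distr (restrict_space ?H V) ?H f"
  have space: "space (restrict_space ?H V) = V"
    using V sets.sets_into_space by (auto simp: space_restrict_space)
  have sets: "B \<in> sets borel" if "B \<in> sets ?H" for B
    using that by (auto simp: sets_haar_power[OF haar] sets_restrict_space
        intro: sets.Int[OF borel_open[OF open_max_ideal_box]])
  have meas: "f \<in> measurable (restrict_space ?H V) ?H"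
  proof (rule measurableI)
    show "f x \<in> space ?H" if "x \<in> space (restrict_space ?H V)" for x
      using that by (simp add: space space_haar_power[OF haar]) (simp add: V_def)
    show "f -` B \<inter> space (restrict_space ?H V) \<in> sets (restrict_space ?H V)" if "B \<in> sets ?H" for B
      using VH[OF sets[OF that]] V
      by (simp add: space sets_restrict_space_iff Int_commute)
  qed
  have N: "emeasure N B = emeasure ?H (V \<inter> f -` B)" if "B \<in> sets ?H" for B
    using that V by (simp add: N_def emeasure_distr[OF meas] space emeasure_restrict_space Int_commute)
  have box: "max_ideal_box \<in> sets ?H" by (intro haar_power_borel[OF haar] borel_open open_max_ideal_box) simp
  have NV: "emeasure N max_ideal_box = emeasure ?H V"
    unfolding N[OF box] by (rule arg_cong[of _ _ "emeasure ?H"]) (auto simp: V_def)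
  interpret H: prob_space ?H by (rule prob_space_haar_power[OF haar])
  have "N = scale_measure (emeasure N max_ideal_box) ?H"
  proof (rule emeasure_eq_scaled_haar_power[OF haar])
    show "sets N = sets ?H" by (simp add: N_def)
    show "emeasure N max_ideal_box \<noteq> \<infinity>" by (simp add: NV)
    fix a b :: "'m \<Rightarrow> 'p padic" and n :: nat
    assume ab: "a \<in> max_ideal_box" "b \<in> max_ideal_box" and n: "n \<ge> 1"
    obtain \<alpha> where \<alpha>: "\<alpha> \<in> V" "f \<alpha> = a" using surj_on_box[OF ab(1)] .
    obtain \<beta> where \<beta>: "\<beta> \<in> V" "f \<beta> = b" using surj_on_box[OF ab(2)] .
    define v where "v = (\<lambda>k. \<beta> k - \<alpha> k)"
    have v: "v \<in> max_ideal_box"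
      using \<alpha>(1) \<beta>(1) unfolding v_def by (intro max_ideal_box_diff) (simp_all add: V_def)
    \<comment> \<open>Translation by v matches the two preimages: \<open>translate\<close> from
      \<alpha> to \<beta> gives one inclusion, from \<beta> to \<alpha> the other.\<close>
    have "V \<inter> f -` padic_cube a n = (\<lambda>x k. x k + v k) -` (V \<inter> f -` padic_cube b n) \<inter> max_ideal_box"
    proof (intro equalityI subsetI)
      fix x assume "x \<in> V \<inter> f -` padic_cube a n"
      thus "x \<in> (\<lambda>x k. x k + v k) -` (V \<inter> f -` padic_cube b n) \<inter> max_ideal_box"
        using translate[of x \<alpha> \<beta> n] \<alpha> \<beta> n by (auto simp: v_def V_def)
    next
      fix x assume "x \<in> (\<lambda>x k. x k + v k) -` (V \<inter> f -` padic_cube b n) \<inter> max_ideal_box"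
      thus "x \<in> V \<inter> f -` padic_cube a n"
        using translate[of "\<lambda>k. x k + v k" \<beta> \<alpha> n] \<alpha> \<beta> n by (simp add: v_def)
    qed
    thus "emeasure N (padic_cube a n) = emeasure N (padic_cube b n)"
      using haar_power_translate(2)[OF haar v VH[of "padic_cube b n"]] ab n
      by (simp add: N haar_power_cube_measurable[OF haar] open_padic_cube)
  qed
  hence "emeasure N A = emeasure N max_ideal_box * emeasure ?H A"
    by (metis emeasure_scale_measure)
  thus ?thesis using N[of A] A by (simp add: NV haar_power_borel[OF haar])
qed

end

section \<open>Mixing for independent full branches\<close>

text \<open>Cylinders of symbolic dynamics, with words read along the orbit. The base case is
  \<open>\<Omega>\<close> and not \<open>UNIV\<close>, so that the empty word too yields a
  measurable set, of full measure.\<close>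

primrec cylinder :: "'a set \<Rightarrow> ('a \<Rightarrow> 'a) \<Rightarrow> ('i \<Rightarrow> 'a set) \<Rightarrow> 'i list \<Rightarrow> 'a set" where
  "cylinder \<Omega> T C [] = \<Omega>"
| "cylinder \<Omega> T C (i # v) = C i \<inter> T -` cylinder \<Omega> T C v"

text \<open>If one word is a prefix of the other, the cylinders are nested; otherwise the first
  differing letters name disjoint cells.\<close>

lemma Int_stable_cylinders:
  assumes disj: "disjoint_family_on C I" and sub: "\<And>i. i \<in> I \<Longrightarrow> C i \<subseteq> \<Omega>"
  shows "Int_stable (insert {} (cylinder \<Omega> T C ` lists I))"
proof -
  have cyl_sub: "cylinder \<Omega> T C v \<subseteq> \<Omega>" if "v \<in> lists I" for v
    using that sub by (cases v) auto
  have nested: "cylinder \<Omega> T C v \<inter> cylinder \<Omega> T C v' \<in> {{}, cylinder \<Omega> T C v, cylinder \<Omega> T C v'}"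
    if "v \<in> lists I" "v' \<in> lists I" for v v'
    using that
  proof (induction v arbitrary: v' rule: list.induct)
    case Nil
    thus ?case using cyl_sub[of v'] by auto
  next
    case (Cons i v)
    show ?case
    proof (cases v')
      case Nil
      thus ?thesis using Int_absorb2[OF cyl_sub[OF Cons.prems(1)]] by (simp only: cylinder.simps(1)) simp
    next
      case v': (Cons j v'')
      show ?thesis
      proof (cases "i = j")
        case True
        thus ?thesis using Cons.IH[of v''] Cons.prems v' by auto
      next
        case False
        hence "C i \<inter> C j = {}" using disj Cons.prems v' by (auto simp: disjoint_family_on_def)
        thus ?thesis using v' by auto
      qed
    qed
  qed
  show ?thesis
  proof (rule Int_stableI)
    fix D E assume DE: "D \<in> insert {} (cylinder \<Omega> T C ` lists I)" "E \<in> insert {} (cylinder \<Omega> T C ` lists I)"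
    show "D \<inter> E \<in> insert {} (cylinder \<Omega> T C ` lists I)"
    proof (cases "D = {} \<or> E = {}")
      case False
      then obtain v v' where "v \<in> lists I" "D = cylinder \<Omega> T C v" "v' \<in> lists I" "E = cylinder \<Omega> T C v'"
        using DE by blast
      hence "D \<inter> E \<in> {{}, D, E}" using nested by simp
      thus ?thesis using DE by (elim insertE) simp_all
    qed auto
  qed
qed

text \<open>By \<open>branch\<close>, the position after one step is independent of the cell before
  it. Summing over the cells gives invariance, and peeling off letters gives independence of
  cylinders. Limits matter only in passing from cylinders to general \<open>B\<close>.\<close>

lemma (in prob_space) strong_mixing_of_independent_branches:
  assumes count: "countable I"
    and C: "\<And>i. i \<in> I \<Longrightarrow> C i \<in> events"
    and disj: "disjoint_family_on C I"
    and cover: "(\<Union>i\<in>I. C i) = space M"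
    and T: "T \<in> measurable M M"
    and branch: "\<And>i A. i \<in> I \<Longrightarrow> A \<in> events \<Longrightarrow> emeasure M (C i \<inter> T -` A) = emeasure M (C i) * emeasure M A"
    and gen: "events = sigma_sets (space M) (insert {} (cylinder (space M) T C ` lists I))"
    and A: "A \<in> events" and B: "B \<in> events"
  shows "(\<lambda>n. prob ((T ^^ n) -` A \<inter> B)) \<longlonglongrightarrow> prob A * prob B"
proof -
  let ?cyl = "cylinder (space M) T C"
  have C_sub: "C i \<subseteq> space M" if "i \<in> I" for i using sets.sets_into_space[OF C[OF that]] .
  have Int_T: "C i \<inter> T -` E = C i \<inter> (T -` E \<inter> space M)" if "i \<in> I" for i E
    using C_sub[OF that] by blast
  have CT: "C i \<inter> T -` E \<in> events" if "i \<in> I" "E \<in> events" for i E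
    unfolding Int_T[OF that(1)] using C[OF that(1)] measurable_sets[OF T that(2)] by blast
  have prob_branch: "prob (C i \<inter> T -` E) = prob (C i) * prob E" if "i \<in> I" "E \<in> events" for i E
    using branch[OF that] by (simp add: measure_def enn2real_mult)
  have Tn: "(T ^^ n) \<in> measurable M M" for n by (rule measurable_compose_n[OF T])
  have Tn_A: "(T ^^ n) -` A \<inter> space M \<in> events" for n by (rule measurable_sets[OF Tn A])
  have Tn_AE: "(T ^^ n) -` A \<inter> E \<in> events" if "E \<in> events" for n E
  proof -
    have "(T ^^ n) -` A \<inter> E = ((T ^^ n) -` A \<inter> space M) \<inter> E" using sets.sets_into_space[OF that] by blast
    thus ?thesis using sets.Int[OF Tn_A that] by simp
  qed
  have invariant: "prob (T -` E \<inter> space M) = prob E" if E: "E \<in> events" for E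
  proof -
    have "emeasure M (\<Union>i\<in>I. C i \<inter> T -` E) = (\<integral>\<^sup>+i. emeasure M (C i \<inter> T -` E) \<partial>count_space I)"
      using disj CT E by (intro emeasure_UN_countable count) (auto simp: disjoint_family_on_def)
    also have "\<dots> = (\<integral>\<^sup>+i. emeasure M (C i) * emeasure M E \<partial>count_space I)"
      using branch E by (intro nn_integral_cong) simp
    also have "\<dots> = (\<integral>\<^sup>+i. emeasure M (C i) \<partial>count_space I) * emeasure M E"
      by (rule nn_integral_multc) simp
    also have "(\<integral>\<^sup>+i. emeasure M (C i) \<partial>count_space I) = emeasure M (\<Union>i\<in>I. C i)"
      using disj C by (intro emeasure_UN_countable[symmetric] count) auto
    also have "\<dots> = 1" by (simp add: cover emeasure_space_1)
    also have "(\<Union>i\<in>I. C i \<inter> T -` E) = T -` E \<inter> space M" using cover by blast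
    finally show ?thesis by (simp add: measure_def)
  qed
  have invariant_n: "prob ((T ^^ n) -` A \<inter> space M) = prob A" for n
  proof (induction n)
    case 0
    thus ?case using sets.sets_into_space[OF A] by (simp add: Int_absorb2)
  next
    case (Suc n)
    have eq: "(T ^^ Suc n) -` A \<inter> space M = T -` ((T ^^ n) -` A \<inter> space M) \<inter> space M"
      using measurable_space[OF T] by (auto simp: funpow_swap1)
    show ?case by (simp only: eq invariant[OF Tn_A] Suc)
  qed
  have cyl: "?cyl v \<in> events" if "v \<in> lists I" for v
    using that by (induction v) (auto intro: CT)
  \<comment> \<open>Each letter uses up one iterate, so from \<open>length v\<close> steps on the
    formula is exact and not only a limit.\<close>
  have cyl_prob: "prob ((T ^^ n) -` A \<inter> ?cyl v) = prob A * prob (?cyl v)"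
    if "v \<in> lists I" "length v \<le> n" for v n
    using that
  proof (induction v arbitrary: n rule: list.induct)
    case Nil
    thus ?case using invariant_n by (simp add: prob_space)
  next
    case (Cons i v)
    then obtain k where n: "n = Suc k" "length v \<le> k" by (cases n) auto
    have iv: "i \<in> I" "v \<in> lists I" using Cons.prems(1) by auto
    have eq: "(T ^^ n) -` A \<inter> ?cyl (i # v) = C i \<inter> T -` ((T ^^ k) -` A \<inter> ?cyl v)"
      by (auto simp: n(1) funpow_swap1)
    have "prob ((T ^^ n) -` A \<inter> ?cyl (i # v)) = prob (C i) * prob ((T ^^ k) -` A \<inter> ?cyl v)"
      unfolding eq by (rule prob_branch[OF iv(1) Tn_AE[OF cyl[OF iv(2)]]])
    also have "prob ((T ^^ k) -` A \<inter> ?cyl v) = prob A * prob (?cyl v)"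
      by (rule Cons.IH[OF iv(2) n(2)])
    finally show ?case using prob_branch[OF iv(1) cyl[OF iv(2)]] by simp
  qed
  have "Int_stable (insert {} (?cyl ` lists I))" by (rule Int_stable_cylinders[OF disj C_sub])
  moreover have "insert {} (?cyl ` lists I) \<subseteq> Pow (space M)" using cyl sets.sets_into_space by blast
  moreover have "B \<in> sigma_sets (space M) (insert {} (?cyl ` lists I))" using B gen by simp
  ultimately show ?thesis
  proof (induction rule: sigma_sets_induct_disjoint)
    case (basic B)
    show ?case
    proof (cases "B = {}")
      case False
      then obtain v where v: "v \<in> lists I" "B = ?cyl v" using basic by blast
      have "\<forall>\<^sub>F n in sequentially. prob ((T ^^ n) -` A \<inter> B) = prob A * prob B"
        using cyl_prob[OF v(1)] v(2) unfolding eventually_sequentially by blast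
      thus ?thesis by (rule tendsto_eventually)
    qed simp
  next
    case empty
    show ?case by simp
  next
    case (compl B)
    have B: "B \<in> events" using compl(1) gen by simp
    \<comment> \<open>Here \<open>invariant_n\<close> makes the total from which one subtracts
      independent of n.\<close>
    have "prob ((T ^^ n) -` A \<inter> (space M - B)) = prob A - prob ((T ^^ n) -` A \<inter> B)" for n
    proof -
      have "(T ^^ n) -` A \<inter> (space M - B) = ((T ^^ n) -` A \<inter> space M) - ((T ^^ n) -` A \<inter> B)" by blast
      thus ?thesis
        using finite_measure_Diff[OF Tn_A Tn_AE[OF B]] sets.sets_into_space[OF B] invariant_n[of n] by (simp add: le_infI2)
    qed
    thus ?case using tendsto_diff[OF tendsto_const compl(2), of "prob A"] B
      by (simp add: prob_compl right_diff_distrib)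
  next
    case (union B)
    have B: "B i \<in> events" for i using union(2) gen by blast
    have sums: "(\<lambda>i. prob (B i)) sums prob (\<Union>i. B i)"
      using B union(1) by (intro finite_measure_UNION) auto
    have "(\<lambda>i. prob ((T ^^ n) -` A \<inter> B i)) sums prob (\<Union>i. (T ^^ n) -` A \<inter> B i)" for n
    proof (rule finite_measure_UNION)
      show "range (\<lambda>i. (T ^^ n) -` A \<inter> B i) \<subseteq> events" using Tn_AE[OF B] by blast
      show "disjoint_family (\<lambda>i. (T ^^ n) -` A \<inter> B i)"
        by (rule disjoint_family_subset[OF union(1)]) blast
    qed
    hence eq: "prob ((T ^^ n) -` A \<inter> (\<Union>i. B i)) = (\<Sum>i. prob ((T ^^ n) -` A \<inter> B i))" for n
      unfolding Int_UN_distrib by (rule sums_unique)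
    have "(\<lambda>n. \<Sum>i. prob ((T ^^ n) -` A \<inter> B i)) \<longlonglongrightarrow> (\<Sum>i. prob A * prob (B i))"
    \<comment> \<open>Limit and sum are interchanged by domination: the terms are at most prob (B
      i), which is summable and free of n.\<close>
    proof (rule tannerys_theorem[THEN conjunct2, THEN conjunct2])
      show "\<forall>\<^sub>F (i, n) in at_top \<times>\<^sub>F sequentially. norm (prob ((T ^^ n) -` A \<inter> B i)) \<le> prob (B i)"
        by (intro always_eventually) (simp add: case_prod_beta finite_measure_mono[OF Int_lower2 B])
      show "summable (\<lambda>i. prob (B i))" using sums by (simp add: sums_iff)
    qed (rule union(3), simp)
    also have "(\<Sum>i. prob A * prob (B i)) = prob A * prob (\<Union>i. B i)"
      using sums_unique[OF sums_mult[OF sums]] by simp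
    finally show ?case by (simp only: eq)
  qed
qed

section \<open>Continued fraction systems\<close>

lemma hyperbolic_lftE:
  fixes F :: "('m::finite \<Rightarrow> 'p::prime_card padic) \<Rightarrow> ('m \<Rightarrow> 'p padic)"
  assumes "hyperbolic_lft F"
  obtains i \<sigma> and u w :: "'m \<Rightarrow> 'p padic"
    where "hyperbolic_map i \<sigma> u w" "\<forall>x\<in>D\<^sub>m. F x = hyperbolic_map.f i \<sigma> u w x"
proof -
  obtain i \<sigma> P Q where F: "has_lft_parameter F i \<sigma> P Q" and hyp: "hyperbolic_parameter TYPE('p) i \<sigma> P Q"
    using assms by (auto simp: hyperbolic_lft_def)
  define u w :: "'m \<Rightarrow> 'p padic" where "u = (\<lambda>k. of_rat (P k))" and "w = (\<lambda>k. of_rat (Q k))"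
  define s where "s = inv \<sigma> i"
  define R where "R = padic_abs (u s) / padic_abs (w s)"
  have ord_1: "padic_ord (1 :: 'p padic) = 0"
    using padic_ord_of_rat[where 'p = 'p, of 1] by (simp add: rat_eord_def rat_ord_1[OF prime_card])
  have u: "u k \<noteq> 0" for k using F by (simp add: u_def has_lft_parameter_def)
  have ord_div: "padic_ord (of_rat (P k / Q k) :: 'p padic) = padic_ord (u k / w k)" for k
    by (simp add: u_def w_def of_rat_divide)
  have h: "padic_ord (w s) \<le> 0" "padic_ord (u s / w s) > 0"
    "\<And>k. k \<noteq> s \<Longrightarrow> padic_ord (w k) \<le> 0 \<Longrightarrow> padic_ord (u s / w s) - padic_ord (u k / w k) > 0"
    "\<And>k. k \<noteq> s \<Longrightarrow> padic_ord (w k) > 0 \<Longrightarrow> padic_ord (u s / w s) - padic_ord (u k) > 0"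
    using hyp unfolding hyperbolic_parameter_def Let_def ord_div s_def[symmetric]
    by (auto simp: u_def w_def)
  have ws: "padic_abs (w s) \<ge> 1"
    using padic_abs_le_iff_ord_le[of 1 "w s"] h(1) by (simp add: ord_1)
  hence ws0: "w s \<noteq> 0" by auto
  have abs_div: "padic_abs (u s / w s) = R" by (simp add: R_def padic_abs_divide)
  have R_pos: "R > 0" using u ws0 by (simp flip: abs_div)
  \<comment> \<open>Subtraction in \<open>ereal\<close> does no harm: the first valuation is finite,
    and an infinite second one would make the difference negative.\<close>
  have abs_less: "padic_abs (u s / w s) < padic_abs y" if "padic_ord (u s / w s) - padic_ord y > 0" for y :: "'p padic"
  proof -
    have "u s / w s \<noteq> 0" using u ws0 by simp
    hence "padic_ord y < padic_ord (u s / w s)"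
      using that by (cases y rule: padic_ord_cases; cases "u s / w s" rule: padic_ord_cases) auto
    thus ?thesis by (simp add: padic_abs_less_iff_ord_less)
  qed
  \<comment> \<open>The two cases of the definition, split by the sign of the valuation of w_k, are
    one inequality with max 1 |w_k|.\<close>
  have R_less: "R * max 1 (padic_abs (w k)) < padic_abs (u k)" if k: "k \<noteq> s" for k
  proof (cases "padic_ord (w k) \<le> 0")
    case True
    hence wk: "padic_abs (w k) \<ge> 1" using padic_abs_le_iff_ord_le[of 1 "w k"] by (simp add: ord_1)
    have "R < padic_abs (u k) / padic_abs (w k)"
      using abs_less[OF h(3)[OF k True]] unfolding abs_div by (simp add: padic_abs_divide)
    moreover have "padic_abs (w k) > 0" using wk by linarith
    ultimately have "R * padic_abs (w k) < padic_abs (u k)" by (simp only: pos_less_divide_eq)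
    thus ?thesis using wk by (simp add: max_absorb2)
  next
    case False
    hence "padic_abs (w k) < 1" using padic_abs_less_iff_ord_less[of "w k" 1] by (simp add: ord_1)
    moreover have "R < padic_abs (u k)" using abs_less[OF h(4)[OF k]] False by (simp add: abs_div)
    ultimately show ?thesis by simp
  qed
  have R_less': "R < padic_abs (u k)" "R * padic_abs (w k) < padic_abs (u k)" if k: "k \<noteq> s" for k
  proof -
    have "R * 1 \<le> R * max 1 (padic_abs (w k))" "R * padic_abs (w k) \<le> R * max 1 (padic_abs (w k))"
      using R_pos by (intro mult_left_mono; simp)+
    thus "R < padic_abs (u k)" "R * padic_abs (w k) < padic_abs (u k)" using R_less[OF k] by linarith+
  qed
  have "hyperbolic_map i \<sigma> u w"
  proof (unfold_locales, fold s_def, fold R_def)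
    show "bij \<sigma>" using F by (simp add: has_lft_parameter_def)
    show "R \<le> 1 / real CARD('p)"
      using padic_abs_less_imp_le[of "u s / w s" 1] padic_abs_less_iff_ord_less[of "u s / w s" 1] h(2)
      by (simp add: ord_1 abs_div)
    fix k assume k: "k \<noteq> s"
    show "R \<le> padic_abs (u k) / real CARD('p)"
      using padic_abs_less_imp_le[of "u s / w s" "u k"] R_less'(1)[OF k] by (simp add: abs_div)
    \<comment> \<open>The left side is the absolute value of the field element u_s / w_s * w_k, so
      discreteness applies to it.\<close>
    show "R * padic_abs (w k) \<le> padic_abs (u k) / real CARD('p)"
      using padic_abs_less_imp_le[of "u s / w s * w k" "u k"] R_less'(2)[OF k]
      by (simp only: padic_abs_mult abs_div)
  qed (use u ws in auto)
  moreover from this have "hyperbolic_map.f i \<sigma> u w x = lft i \<sigma> P Q x" for x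
    by (simp add: hyperbolic_map.f_def lft_def u_def w_def fun_eq_iff)
  hence "F x = hyperbolic_map.f i \<sigma> u w x" if "x \<in> D\<^sub>m" for x
    using F that by (simp add: has_lft_parameter_def)
  ultimately show ?thesis using that by blast
qed

lemma indep_vectors_nonzero:
  assumes "x \<in> D\<^sub>m" shows "x i \<noteq> 0"
proof
  assume "x i = 0"
  hence rel: "of_int 0 * 1 + (\<Sum>k\<in>UNIV. of_int (if k = i then 1 else 0) * x k) = 0"
    by (simp add: if_distrib[of "\<lambda>z. of_int z * _"] cong: if_cong)
  have ind: "of_int c\<^sub>0 * 1 + (\<Sum>k\<in>UNIV. of_int (c k) * x k) = 0 \<Longrightarrow> \<forall>k. c k = 0" for c\<^sub>0 c
    using assms unfolding indep_vectors_def by blast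
  show False using ind[OF rel] by (metis zero_neq_one)
qed

text \<open>With a target inside \<open>D\<^sub>m'\<close>, independence of the image is automatic.
  What separates the cell from a preimage in \<open>V\<close> is only independence of the point
  itself, which fails on a null set of the box.\<close>

lemma lft_cell_eq:
  assumes map: "hyperbolic_map i \<sigma> u w" and F: "\<forall>x\<in>D\<^sub>m. F x = hyperbolic_map.f i \<sigma> u w x"
    and sub: "lft_cell F \<subseteq> max_ideal_box" and A: "A \<subseteq> D\<^sub>m'"
  shows "lft_cell F \<inter> F -` A = (hyperbolic_map.V i \<sigma> u w \<inter> hyperbolic_map.f i \<sigma> u w -` A) \<inter> D\<^sub>m"
    (is "?L = ?R")
proof (intro equalityI subsetI)
  fix x assume x: "x \<in> ?L"
  hence "x \<in> D\<^sub>m" "x \<in> max_ideal_box" "F x \<in> A" using sub by (auto simp: lft_cell_def)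
  moreover have "F x \<in> max_ideal_box" using \<open>F x \<in> A\<close> A by (auto simp: indep_vectors_max_ideal_eq)
  ultimately show "x \<in> ?R"
    using F indep_vectors_nonzero[of x i] by (simp add: hyperbolic_map.V_def[OF map])
next
  fix x assume "x \<in> ?R"
  thus "x \<in> ?L" using F A by (auto simp: lft_cell_def)
qed

lemma lft_cell_contraction:
  fixes F :: "('m::finite \<Rightarrow> 'p::prime_card padic) \<Rightarrow> ('m \<Rightarrow> 'p padic)"
  assumes "hyperbolic_lft F" "lft_cell F \<subseteq> max_ideal_box" "x \<in> lft_cell F" "y \<in> lft_cell F" "F x \<in> padic_cube (F y) n"
  shows "x \<in> padic_cube y (Suc n)"
proof -
  obtain i \<sigma> and u w :: "'m \<Rightarrow> 'p padic" where uw: "hyperbolic_map i \<sigma> u w"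
    and F: "\<forall>x\<in>D\<^sub>m. F x = hyperbolic_map.f i \<sigma> u w x"
    using hyperbolic_lftE[OF assms(1)] by blast
  have cell: "lft_cell F = (hyperbolic_map.V i \<sigma> u w \<inter> hyperbolic_map.f i \<sigma> u w -` D\<^sub>m') \<inter> D\<^sub>m"
    using lft_cell_eq[OF uw F assms(2), of "D\<^sub>m'"] by (auto simp: lft_cell_def)
  have "padic_abs (x j - y j) \<le> (1 / real CARD('p) ^ n) / real CARD('p)" for j
  proof (rule hyperbolic_map.contraction[OF uw])
    show "x \<in> hyperbolic_map.V i \<sigma> u w" "y \<in> hyperbolic_map.V i \<sigma> u w"
      using assms(3,4) unfolding cell by blast+
    have "x \<in> D\<^sub>m" "y \<in> D\<^sub>m" using assms(3,4) by (simp_all add: lft_cell_def)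
    thus "padic_abs (hyperbolic_map.f i \<sigma> u w x k - hyperbolic_map.f i \<sigma> u w y k) \<le> 1 / real CARD('p) ^ n" for k
      using assms(5) F by (simp add: padic_cube_def)
  qed
  thus ?thesis by (simp add: padic_cube_def mult.commute)
qed

text \<open>The factor is computed on \<open>V\<close>, and intersecting with
  \<open>D\<^sub>m\<close> changes no measure. Taking all of \<open>D\<^sub>m'\<close>, which has
  measure 1, as target shows that this factor is the measure of the cell.\<close>

lemma lft_cell_branch:
  fixes F :: "('m::finite \<Rightarrow> 'p::prime_card padic) \<Rightarrow> ('m \<Rightarrow> 'p padic)"
  assumes haar: "normalized_haar \<mu>" and hyp: "hyperbolic_lft F" and sub: "lft_cell F \<subseteq> max_ideal_box"
    and A: "A \<in> sets borel" "A \<subseteq> D\<^sub>m'"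
  shows "lft_cell F \<inter> F -` A \<in> sets borel"
    and "emeasure (haar_power \<mu>) (lft_cell F \<inter> F -` A)
      = emeasure (haar_power \<mu>) (lft_cell F) * emeasure (haar_power \<mu>) A"
proof -
  let ?H = "haar_power \<mu> :: ('m \<Rightarrow> 'p padic) measure"
  interpret prob_space ?H by (rule prob_space_haar_power[OF haar])
  obtain i \<sigma> and u w :: "'m \<Rightarrow> 'p padic" where uw: "hyperbolic_map i \<sigma> u w"
    and F: "\<forall>x\<in>D\<^sub>m. F x = hyperbolic_map.f i \<sigma> u w x"
    using hyperbolic_lftE[OF hyp] by blast
  note cell = lft_cell_eq[OF uw F sub]
  let ?V = "hyperbolic_map.V i \<sigma> u w" and ?f = "hyperbolic_map.f i \<sigma> u w"
  have V_sub: "?V \<subseteq> max_ideal_box" by (auto simp: hyperbolic_map.V_def[OF uw])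
  show "lft_cell F \<inter> F -` A \<in> sets borel"
    unfolding cell[OF A(2)]
    by (intro sets.Int[OF hyperbolic_map.V_vimage_borel[OF uw A(1)] indep_vectors_borel])
  have ae: "emeasure ?H (B \<inter> D\<^sub>m) = emeasure ?H B" if "B \<in> sets ?H" for B
  proof -
    have "B \<inter> D\<^sub>m = B - (max_ideal_box - D\<^sub>m)"
      using sets.sets_into_space[OF that] by (auto simp: space_haar_power[OF haar])
    thus ?thesis using emeasure_Diff_null_set[OF indep_vectors_complement_null[OF haar] that] by simp
  qed
  have branch: "emeasure ?H (lft_cell F \<inter> F -` B) = emeasure ?H ?V * emeasure ?H B"
    if B: "B \<in> sets borel" "B \<subseteq> D\<^sub>m'" for B
  proof -
    have "?V \<inter> ?f -` B \<in> sets ?H"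
      using hyperbolic_map.V_vimage_borel[OF uw B(1)] V_sub by (intro haar_power_borel[OF haar]) auto
    hence "emeasure ?H (lft_cell F \<inter> F -` B) = emeasure ?H (?V \<inter> ?f -` B)"
      unfolding cell[OF B(2)] by (rule ae)
    also have "\<dots> = emeasure ?H ?V * emeasure ?H B"
      using B by (intro hyperbolic_map.emeasure_vimage[OF uw haar]) (auto simp: indep_vectors_max_ideal_eq)
    finally show ?thesis .
  qed
  have "max_ideal_box \<in> sets ?H" by (metis sets.top space_haar_power[OF haar])
  from ae[OF this] have "emeasure ?H D\<^sub>m' = 1"
    using emeasure_space_1 by (simp add: indep_vectors_max_ideal_eq space_haar_power[OF haar] Int_commute)
  moreover have "lft_cell F \<inter> F -` D\<^sub>m' = lft_cell F" by (auto simp: lft_cell_def)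
  ultimately have "emeasure ?H (lft_cell F) = emeasure ?H ?V"
    using branch[OF indep_vectors_max_ideal_borel] by simp
  thus "emeasure ?H (lft_cell F \<inter> F -` A) = emeasure ?H (lft_cell F) * emeasure ?H A"
    using branch[OF A] by simp
qed

theorem theorem5p8:
  fixes F :: "'l \<Rightarrow> ('m::finite \<Rightarrow> 'p::prime_card padic) \<Rightarrow> ('m \<Rightarrow> 'p padic)"
    and \<Lambda> :: "'l set"
    and T :: "('m \<Rightarrow> 'p padic) \<Rightarrow> ('m \<Rightarrow> 'p padic)"
    and \<mu> :: "'p padic measure"
    and A B :: "('m \<Rightarrow> 'p padic) set"
  assumes "normalized_haar \<mu>"
    and "continued_fraction_system \<Lambda> F"
    and "T = cf_map \<Lambda> F"
    and "A \<in> sets borel" and "A \<subseteq> D\<^sub>m'"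
    and "B \<in> sets borel" and "B \<subseteq> D\<^sub>m'"
  shows "(\<lambda>n. measure (haar_power \<mu>) ({x \<in> D\<^sub>m'. (T ^^ n) x \<in> A} \<inter> B))
           \<longlonglongrightarrow> measure (haar_power \<mu>) A * measure (haar_power \<mu>) B"
proof -
  let ?H = "haar_power \<mu> :: ('m \<Rightarrow> 'p padic) measure"
  let ?D = "D\<^sub>m' :: ('m \<Rightarrow> 'p padic) set"
  define C where "C = (\<lambda>l. lft_cell (F l))"
  \<comment> \<open>The mixing lemma is applied on \<open>D\<^sub>m'\<close> and not on the box: the
    cells cover exactly \<open>D\<^sub>m'\<close>, and the values of \<open>T\<close> are meaningful
    there.\<close>
  define M where "M = restrict_space ?H ?D"
  note haar = assms(1)
  have count: "countable \<Lambda>" and hyp: "\<And>l. l \<in> \<Lambda> \<Longrightarrow> hyperbolic_lft (F l)"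
    and disj: "disjoint_family_on C \<Lambda>" and cover: "(\<Union>l\<in>\<Lambda>. C l) = ?D"
    using assms(2) by (auto simp: continued_fraction_system_def C_def)
  have sub: "lft_cell (F l) \<subseteq> max_ideal_box" if "l \<in> \<Lambda>" for l
    using cover that by (auto simp: C_def indep_vectors_max_ideal_eq)
  have D_H: "?D \<in> sets ?H"
    by (intro haar_power_borel[OF haar] indep_vectors_max_ideal_borel) (simp add: indep_vectors_max_ideal_eq)
  have T_eq: "T x = F l x" if "l \<in> \<Lambda>" "x \<in> C l" for l x
  proof -
    have "(THE l. l \<in> \<Lambda> \<and> x \<in> lft_cell (F l)) = l"
      using that disj by (intro the_equality) (auto simp: C_def disjoint_family_on_def)
    thus ?thesis by (simp add: assms(3) cf_map_def)
  qed
  have C_T: "C l \<inter> T -` E = lft_cell (F l) \<inter> F l -` E" if "l \<in> \<Lambda>" for l E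
    using T_eq[OF that] by (auto simp: C_def)
  have space_M: "space M = ?D"
    using sets.sets_into_space[OF D_H] by (auto simp: M_def space_restrict_space)
  have sets_M: "sets M = sets (restrict_space borel ?D)"
  proof -
    have "sets M = (\<inter>) ?D ` (\<inter>) max_ideal_box ` sets borel"
      by (simp add: M_def sets_restrict_space sets_haar_power[OF haar])
    also have "\<dots> = (\<inter>) ?D ` sets borel"
      by (auto simp: image_image indep_vectors_max_ideal_eq intro!: image_cong)
    finally show ?thesis by (simp add: sets_restrict_space)
  qed
  have sets_M_iff: "E \<in> sets M \<longleftrightarrow> E \<in> sets borel \<and> E \<subseteq> ?D" for E
    unfolding sets_M by (subst sets_restrict_space_iff) (auto simp: indep_vectors_max_ideal_borel)
  have emeasure_M: "emeasure M E = emeasure ?H E" if "E \<subseteq> ?D" for E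
    unfolding M_def using D_H that by (intro emeasure_restrict_space) auto
  interpret H: prob_space ?H by (rule prob_space_haar_power[OF haar])
  have "emeasure ?H ?D = 1"
  proof -
    have "?D = space ?H - (max_ideal_box - D\<^sub>m)"
      by (auto simp: indep_vectors_max_ideal_eq space_haar_power[OF haar])
    thus ?thesis
      using emeasure_Diff_null_set[OF indep_vectors_complement_null[OF haar] sets.top[of ?H]] H.emeasure_space_1
      by simp
  qed
  then interpret prob_space M by (intro prob_spaceI) (simp add: space_M emeasure_M)
  have C_M: "C l \<inter> T -` E \<in> sets M" if "l \<in> \<Lambda>" "E \<in> sets M" for l E
    using lft_cell_branch(1)[OF haar hyp[OF that(1)] sub[OF that(1)], of E] that cover C_T[OF that(1), of E]
    by (auto simp: sets_M_iff)
  have C_D: "C l \<inter> T -` ?D = C l" if "l \<in> \<Lambda>" for l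
    unfolding C_T[OF that] by (auto simp: C_def lft_cell_def)
  have D_M: "?D \<in> sets M" by (metis sets.top space_M)
  have T_D: "T x \<in> ?D" if "x \<in> ?D" for x
    using that C_D unfolding cover[symmetric] by blast
  have T_M: "T \<in> measurable M M"
  proof (rule measurableI)
    fix E assume E: "E \<in> sets M"
    have "(\<Union>l\<in>\<Lambda>. C l \<inter> T -` E) \<in> sets M" using C_M E count by (intro sets.countable_UN') auto
    also have "(\<Union>l\<in>\<Lambda>. C l \<inter> T -` E) = T -` E \<inter> space M" unfolding space_M cover[symmetric] by blast
    finally show "T -` E \<inter> space M \<in> sets M" .
  qed (simp add: space_M T_D)
  let ?cyl = "cylinder ?D T C"
  have cyl_M: "?cyl v \<in> sets M" if "v \<in> lists \<Lambda>" for v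
    using that by (induction v) (auto intro: C_M D_M)
  \<comment> \<open>The box has level 1, and every letter adds a level by the contraction; hence
    \<open>Suc\<close>.\<close>
  have small: "x \<in> padic_cube y (Suc (length v))" if "v \<in> lists \<Lambda>" "x \<in> ?cyl v" "y \<in> ?cyl v" for v x y
    using that
  proof (induction v arbitrary: x y rule: list.induct)
    case Nil
    hence "x \<in> padic_cube (\<lambda>_. 0) 1" "y \<in> padic_cube (\<lambda>_. 0) 1"
      unfolding max_ideal_box_eq_cube[symmetric] by (simp_all add: indep_vectors_max_ideal_eq)
    thus ?case using padic_cube_eq[of y "\<lambda>_. 0" 1] by simp
  next
    case (Cons l v)
    have l: "l \<in> \<Lambda>" using Cons.prems(1) by simp
    have xy: "x \<in> lft_cell (F l)" "y \<in> lft_cell (F l)" using Cons.prems by (auto simp: C_def)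
    have "F l x \<in> padic_cube (F l y) (Suc (length v))"
      using Cons T_eq[OF l] by (auto simp: C_def)
    thus ?case using lft_cell_contraction[OF hyp[OF l] sub[OF l] xy] by simp
  qed
  \<comment> \<open>Itineraries of every length exist because \<open>T\<close> maps
    \<open>D\<^sub>m'\<close> to itself. So cylinders of arbitrarily small diameter surround each
    point, which makes them generators.\<close>
  have word: "\<exists>v\<in>lists \<Lambda>. length v = n \<and> x \<in> ?cyl v" if "x \<in> ?D" for n x
    using that
  proof (induction n arbitrary: x)
    case (Suc n)
    obtain l where l: "l \<in> \<Lambda>" "x \<in> C l" using Suc.prems cover by blast
    obtain v where "v \<in> lists \<Lambda>" "length v = n" "T x \<in> ?cyl v" using Suc.IH[OF T_D[OF Suc.prems]] by blast
    thus ?case using l by (intro bexI[of _ "l # v"]) auto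
  qed simp
  have gen: "sets M = sigma_sets ?D (insert {} (?cyl ` lists \<Lambda>))"
    unfolding sets_M
  proof (rule sets_restrict_borel_eq_sigma_sets)
    show "insert {} (?cyl ` lists \<Lambda>) \<subseteq> sets (restrict_space borel ?D)"
      unfolding sets_M[symmetric] using cyl_M by auto
    fix S :: "('m \<Rightarrow> 'p padic) set" assume S: "open S"
    let ?W = "{v \<in> lists \<Lambda>. ?cyl v \<subseteq> S}"
    have "countable ?W" by (rule countable_subset[OF _ countable_lists[OF count]]) auto
    moreover have "S \<inter> ?D = (\<Union>v\<in>?W. ?cyl v)"
    proof (intro equalityI subsetI)
      fix x assume x: "x \<in> S \<inter> ?D"
      then obtain n where n: "padic_cube x n \<subseteq> S" using open_contains_padic_cube[OF S, of x] by blast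
      obtain v where v: "v \<in> lists \<Lambda>" "length v = n" "x \<in> ?cyl v" using word[of x n] x by blast
      have "?cyl v \<subseteq> padic_cube x n"
        using small[OF v(1) _ v(3)] padic_cube_mono[of n "Suc n" x] v(2) by auto
      thus "x \<in> (\<Union>v\<in>?W. ?cyl v)" using v n by blast
    next
      fix x assume "x \<in> (\<Union>v\<in>?W. ?cyl v)"
      thus "x \<in> S \<inter> ?D" using cyl_M unfolding sets_M_iff by blast
    qed
    moreover have "(\<Union>v\<in>?W. ?cyl v) \<in> sigma_sets ?D (insert {} (?cyl ` lists \<Lambda>))"
      using \<open>countable ?W\<close> by (intro sigma_sets_UNION) (auto intro: sigma_sets.Basic)
    ultimately show "S \<inter> ?D \<in> sigma_sets ?D (insert {} (?cyl ` lists \<Lambda>))" by simp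
  qed
  have "(\<lambda>n. prob ((T ^^ n) -` A \<inter> B)) \<longlonglongrightarrow> prob A * prob B"
  proof (rule strong_mixing_of_independent_branches[OF count _ disj _ T_M])
    show "C l \<in> events" if "l \<in> \<Lambda>" for l using C_M[OF that D_M] by (simp add: C_D[OF that])
    fix l E assume l: "l \<in> \<Lambda>" and E: "E \<in> events"
    have "C l \<subseteq> ?D" using cover l by blast
    hence "C l \<inter> T -` E \<subseteq> ?D" "C l \<subseteq> ?D" "E \<subseteq> ?D" "E \<in> sets borel"
      using E by (auto simp: sets_M_iff)
    thus "emeasure M (C l \<inter> T -` E) = emeasure M (C l) * emeasure M E"
      using lft_cell_branch(2)[OF haar hyp[OF l] sub[OF l], of E]
      by (simp only: emeasure_M C_T[OF l]) (simp add: C_def)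
  qed (use cover gen assms(4-7) in \<open>auto simp: space_M sets_M_iff\<close>)
  moreover have "prob E = measure ?H E" if "E \<subseteq> ?D" for E
    using emeasure_M[OF that] by (simp add: measure_def)
  moreover have "{x \<in> ?D. (T ^^ n) x \<in> A} \<inter> B = (T ^^ n) -` A \<inter> B" for n
    using assms(7) by blast
  ultimately show ?thesis using assms(5,7) by (simp add: le_infI2)
qed

end
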